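(* Let $\mathcal L$ be the set of conjugacy classes (in $\mathrm{SL}(2,\mathbb H)$) of loxodromic elements of $\mathrm{SL}(2,\mathbb H)$. Then the map $$\Theta\colon\mathcal L\longrightarrow\mathbb R^3,\qquad [A]\longmapsto\bigl(\mathrm{tr}(A),\mathrm{tr}(A^{-1}),\nu(A)\bigr)$$ is injective, and so is the map $[A]\mapsto\bigl(\mathrm{tr}(A),\mathrm{tr}(A^{-1}),\mathrm{tr}(A^2)\bigr)$ on $\mathcal L$; the two triples determine one another. Restricted to the set of conjugacy classes of regular loxodromic elements, $\Theta$ is a real-analytic diffeomorphism onto the open set $$\mathcal D=\Bigl\{(x,y,z)\in\mathbb R^3:\ z>2,\ \ \Bigl|\frac{x+y}{\sqrt{z+2}}+\frac{x-y}{\sqrt{z-2}}\Bigr|<2\ \text{ and }\ \Bigl|\frac{x+y}{\sqrt{z+2}}-\frac{x-y}{\sqrt{z-2}}\Bigr|<2\Bigr\}.$$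
   Context: $\mathbb H$ denotes the quaternions, with real part $\mathrm{Re}$ and norm $|\cdot|$; $\mathbb S^2=\{I\in\mathbb H: I^2=-1\}$ is the sphere of unit imaginary quaternions, and $e^{I\theta}=\cos\theta+I\sin\theta$ for $I\in\mathbb S^2$. The Dieudonné determinant of $\left(\begin{smallmatrix}a&b\\c&d\end{smallmatrix}\right)\in\mathrm{GL}(2,\mathbb H)$ is $|ad-aca^{-1}b|$ if $a\neq0$ and $|cb|$ if $a=0$; $\mathrm{SL}(2,\mathbb H)$ is the group of matrices of Dieudonné determinant $1$. It acts on $\widehat{\mathbb H}=\mathbb H\cup\{\infty\}$ by $z\mapsto(az+b)(cz+d)^{-1}$. An element $A\in\mathrm{SL}(2,\mathbb H)$ is loxodromic if it has exactly two fixed points in $\widehat{\mathbb H}$, one attracting and one repelling; equivalently, $A$ is conjugate in $\mathrm{SL}(2,\mathbb H)$ to $\mathrm{diag}(re^{I\theta},r^{-1}e^{J\varphi})$ with $r>1$, $\theta,\varphi\in[0,\pi]$, $I,J\in\mathbb S^2$. It is regular loxodromic if moreover $\theta,\varphi\in(0,\pi)$. The numbers $r,\theta,\varphi$ depend only on the conjugacy class. For $A=\left(\begin{smallmatrix}a&b\\c&d\end{smallmatrix}\right)$, $\mathrm{tr}(A):=\mathrm{Re}(a+d)$ (a conjugation-invariant real number). For $A$ loxodromic, conjugate in $\mathrm{SL}(2,\mathbb H)$ to $\mathrm{diag}(re^{I\theta},r^{-1}e^{J\varphi})$ with $r>1$, $\theta,\varphi\in[0,\pi]$, $I,J\in\mathbb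 S^2$, $\nu(A):=r^2+r^{-2}$. The set of regular loxodromic conjugacy classes is in bijection with $(1,\infty)\times(0,\pi)^2$ via $(r,\theta,\varphi)$ and carries the resulting real-analytic structure. *)

theory Defs
  imports "HOL-Analysis.Analysis"
begin

section \<open>The quaternions as a normed division algebra\<close>

datatype quat = Quat (qRe: real) (qI: real) (qJ: real) (qK: real)

lemma quat_eq_iff: "x = y \<longleftrightarrow> qRe x = qRe y \<and> qI x = qI y \<and> qJ x = qJ y \<and> qK x = qK y"
  by (cases x; cases y) simp

instantiation quat :: ab_group_add
begin

definition "0 = Quat 0 0 0 0"
definition "x + y = Quat (qRe x + qRe y) (qI x + qI y) (qJ x + qJ y) (qK x + qK y)"
definition "- x = Quat (- qRe x) (- qI x) (- qJ x) (- qK x)"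
definition "x - y = Quat (qRe x - qRe y) (qI x - qI y) (qJ x - qJ y) (qK x - qK y)"

instance
  by standard
    (simp_all add: quat_eq_iff zero_quat_def plus_quat_def uminus_quat_def minus_quat_def)

end

lemma quat_add_sel [simp]:
  "qRe 0 = 0" "qI 0 = 0" "qJ 0 = 0" "qK 0 = 0"
  "qRe (x + y) = qRe x + qRe y" "qI (x + y) = qI x + qI y"
  "qJ (x + y) = qJ x + qJ y" "qK (x + y) = qK x + qK y"
  "qRe (- x) = - qRe x" "qI (- x) = - qI x" "qJ (- x) = - qJ x" "qK (- x) = - qK x"
  "qRe (x - y) = qRe x - qRe y" "qI (x - y) = qI x - qI y"
  "qJ (x - y) = qJ x - qJ y" "qK (x - y) = qK x - qK y"
  by (simp_all add: zero_quat_def plus_quat_def uminus_quat_def minus_quat_def)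

instantiation quat :: ring_1
begin

definition "1 = Quat 1 0 0 0"
definition "x * y = Quat
  (qRe x * qRe y - qI x * qI y - qJ x * qJ y - qK x * qK y)
  (qRe x * qI y + qI x * qRe y + qJ x * qK y - qK x * qJ y)
  (qRe x * qJ y - qI x * qK y + qJ x * qRe y + qK x * qI y)
  (qRe x * qK y + qI x * qJ y - qJ x * qI y + qK x * qRe y)"

instance
  by standard (simp_all add: quat_eq_iff one_quat_def times_quat_def algebra_simps)

end

lemma quat_mult_sel [simp]:
  "qRe 1 = 1" "qI 1 = 0" "qJ 1 = 0" "qK 1 = 0"
  "qRe (x * y) = qRe x * qRe y - qI x * qI y - qJ x * qJ y - qK x * qK y"
  "qI (x * y) = qRe x * qI y + qI x * qRe y + qJ x * qK y - qK x * qJ y"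
  "qJ (x * y) = qRe x * qJ y - qI x * qK y + qJ x * qRe y + qK x * qI y"
  "qK (x * y) = qRe x * qK y + qI x * qJ y - qJ x * qI y + qK x * qRe y"
  by (simp_all add: one_quat_def times_quat_def)

instantiation quat :: real_vector
begin

definition "r *\<^sub>R x = Quat (r * qRe x) (r * qI x) (r * qJ x) (r * qK x)" for x :: quat

instance
  by standard (simp_all add: quat_eq_iff scaleR_quat_def algebra_simps)

end

lemma quat_scaleR_sel [simp]:
  "qRe (r *\<^sub>R x) = r * qRe x" "qI (r *\<^sub>R x) = r * qI x"
  "qJ (r *\<^sub>R x) = r * qJ x" "qK (r *\<^sub>R x) = r * qK x"
  by (simp_all add: scaleR_quat_def)

instantiation quat :: real_inner
begin

definition "x \<bullet> y = qRe x * qRe y + qI x * qI y + qJ x * qJ y + qK x * qK y"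
definition "norm (x::quat) = sqrt (x \<bullet> x)"
definition "sgn (x::quat) = x /\<^sub>R norm x"
definition "dist (x::quat) y = norm (x - y)"
definition
  "(uniformity :: (quat \<times> quat) filter) = (INF e\<in>{0 <..}. principal {(x, y). dist x y < e})"
definition
  "open (U :: quat set) \<longleftrightarrow> (\<forall>x\<in>U. eventually (\<lambda>(x', y). x' = x \<longrightarrow> y \<in> U) uniformity)"

instance
proof
  fix x y z :: quat and r :: real
  show "0 \<le> x \<bullet> x"
    by (simp add: inner_quat_def)
  have "x \<bullet> x = 0 \<longleftrightarrow> (qRe x)\<^sup>2 + (qI x)\<^sup>2 + ((qJ x)\<^sup>2 + (qK x)\<^sup>2) = 0"
    by (simp add: inner_quat_def power2_eq_square add.assoc)
  then show "x \<bullet> x = 0 \<longleftrightarrow> x = 0"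
    by (simp add: quat_eq_iff add_nonneg_eq_0_iff)
qed (simp_all add: inner_quat_def norm_quat_def sgn_quat_def
      dist_quat_def uniformity_quat_def open_quat_def algebra_simps)

end

instantiation quat :: real_normed_div_algebra
begin

text \<open>The inverse of \<open>x\<close> is its conjugate divided by its squared norm.\<close>

definition "inverse x = inverse (x \<bullet> x) *\<^sub>R Quat (qRe x) (- qI x) (- qJ x) (- qK x)"
definition "x div y = x * inverse y" for x y :: quat

lemma quat_mult_inverse_aux:
  fixes x :: quat
  assumes "x \<noteq> 0"
  shows "inverse x * x = 1" "x * inverse x = 1"
proof -
  have "x \<bullet> x \<noteq> 0"
    using assms by simp
  moreover have "inverse x * x = inverse (x \<bullet> x) *\<^sub>R ((x \<bullet> x) *\<^sub>R 1)"
    and "x * inverse x = inverse (x \<bullet> x) *\<^sub>R ((x \<bullet> x) *\<^sub>R 1)"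
    by (simp_all add: quat_eq_iff inverse_quat_def inner_quat_def algebra_simps)
  ultimately show "inverse x * x = 1" "x * inverse x = 1"
    by simp_all
qed

instance
proof
  fix x y :: quat and r :: real
  show "x \<noteq> 0 \<Longrightarrow> inverse x * x = 1" "x \<noteq> 0 \<Longrightarrow> x * inverse x = 1"
    by (rule quat_mult_inverse_aux; assumption)+
  show "x div y = x * inverse y"
    by (rule divide_quat_def)
  show "inverse (0::quat) = 0"
    by (simp add: inverse_quat_def)
  have "(x * y) \<bullet> (x * y) = (x \<bullet> x) * (y \<bullet> y)"
    by (simp add: inner_quat_def) algebra
  then show "norm (x * y) = norm x * norm y"
    by (simp add: norm_quat_def real_sqrt_mult)
qed (simp_all add: quat_eq_iff algebra_simps)

end

text \<open>The sphere of unit imaginary quaternions, and \<open>exp (I \<theta>)\<close> for \<open>I\<close> on it.\<close>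

definition imag_units :: "quat set"
  where "imag_units = {I. I\<^sup>2 = -1}"

definition qcis :: "quat \<Rightarrow> real \<Rightarrow> quat"
  where "qcis I t = of_real (cos t) + I * of_real (sin t)"


section \<open>The group SL(2,H) and its action on the one-point compactification of H\<close>

definition Dieudonne_det :: "quat^2^2 \<Rightarrow> real" where
  "Dieudonne_det A =
    (let a = A$1$1; b = A$1$2; c = A$2$1; d = A$2$2
     in if a \<noteq> 0 then norm (a * d - a * c * inverse a * b) else norm (c * b))"

definition SL2H :: "(quat^2^2) set"
  where "SL2H = {A. invertible A \<and> Dieudonne_det A = 1}"

definition diag2 :: "quat \<Rightarrow> quat \<Rightarrow> quat^2^2"
  where "diag2 a d = vector [vector [a, 0], vector [0, d]]"

definition SL2H_conj :: "((quat^2^2) \<times> (quat^2^2)) set" where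
  "SL2H_conj = {(A, B). A \<in> SL2H \<and> B \<in> SL2H \<and> (\<exists>P\<in>SL2H. B = P ** A ** matrix_inv P)}"

definition tr :: "quat^2^2 \<Rightarrow> real"
  where "tr A = qRe (trace A)"

text \<open>The point at infinity is \<^const>\<open>None\<close>.\<close>

definition Hhat :: "quat option topology"
  where "Hhat = Alexandroff_compactification euclidean"

definition moebius :: "quat^2^2 \<Rightarrow> quat option \<Rightarrow> quat option" where
  "moebius A p =
    (let a = A$1$1; b = A$1$2; c = A$2$1; d = A$2$2
     in case p of
          None \<Rightarrow> if c = 0 then None else Some (a * inverse c)
        | Some z \<Rightarrow> if c * z + d = 0 then None else Some ((a * z + b) * inverse (c * z + d)))"


section \<open>Loxodromic elements\<close>

definition attracting :: "(quat option \<Rightarrow> quat option) \<Rightarrow> quat option \<Rightarrow> bool" where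
  "attracting f p \<longleftrightarrow> f p = p \<and>
    (\<exists>U. openin Hhat U \<and> p \<in> U \<and> (\<forall>z\<in>U. limitin Hhat (\<lambda>n. (f ^^ n) z) p sequentially))"

text \<open>A repelling fixed point is an attracting fixed point of the inverse transformation.\<close>

definition loxodromic :: "quat^2^2 \<Rightarrow> bool" where
  "loxodromic A \<longleftrightarrow> A \<in> SL2H \<and>
    (\<exists>p q. p \<noteq> q \<and> {z. moebius A z = z} = {p, q} \<and>
      attracting (moebius A) p \<and> attracting (moebius (matrix_inv A)) q)"

definition lox_normal_form :: "quat^2^2 \<Rightarrow> real \<Rightarrow> real \<Rightarrow> real \<Rightarrow> bool" where
  "lox_normal_form A r \<theta> \<phi> \<longleftrightarrow> r > 1 \<and> \<theta> \<in> {0..pi} \<and> \<phi> \<in> {0..pi} \<and>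
    (\<exists>I\<in>imag_units. \<exists>J\<in>imag_units.
      (A, diag2 (of_real r * qcis I \<theta>) (of_real (inverse r) * qcis J \<phi>)) \<in> SL2H_conj)"

definition lox_params :: "quat^2^2 \<Rightarrow> real \<times> real \<times> real"
  where "lox_params A = (THE (r, \<theta>, \<phi>). lox_normal_form A r \<theta> \<phi>)"

definition nu :: "quat^2^2 \<Rightarrow> real"
  where "nu A = (let r = fst (lox_params A) in r\<^sup>2 + inverse (r\<^sup>2))"

definition regular_loxodromic :: "quat^2^2 \<Rightarrow> bool" where
  "regular_loxodromic A \<longleftrightarrow> loxodromic A \<and>
    (\<exists>r \<theta> \<phi>. lox_normal_form A r \<theta> \<phi> \<and> \<theta> \<in> {0<..<pi} \<and> \<phi> \<in> {0<..<pi})"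


section \<open>Conjugacy classes and functions on them\<close>

definition lox_classes :: "(quat^2^2) set set"
  where "lox_classes = Collect loxodromic // SL2H_conj"

definition reg_lox_classes :: "(quat^2^2) set set"
  where "reg_lox_classes = Collect regular_loxodromic // SL2H_conj"

definition trace_nu :: "quat^2^2 \<Rightarrow> real \<times> real \<times> real"
  where "trace_nu A = (tr A, tr (matrix_inv A), nu A)"

definition trace_sq :: "quat^2^2 \<Rightarrow> real \<times> real \<times> real"
  where "trace_sq A = (tr A, tr (matrix_inv A), tr (A ** A))"

text \<open>The value on a conjugacy class of a conjugation-invariant function of matrices.\<close>

definition on_class :: "(quat^2^2 \<Rightarrow> 'b) \<Rightarrow> (quat^2^2) set \<Rightarrow> 'b"
  where "on_class f C = the_elem (f ` C)"

definition D_region :: "(real \<times> real \<times> real) set" where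
  "D_region = {(x, y, z). z > 2 \<and>
    \<bar>(x + y) / sqrt (z + 2) + (x - y) / sqrt (z - 2)\<bar> < 2 \<and>
    \<bar>(x + y) / sqrt (z + 2) - (x - y) / sqrt (z - 2)\<bar> < 2}"


section \<open>Real-analytic maps\<close>

text \<open>
  Near each point \<open>p\<close> of \<open>S\<close>, the function is the sum of a power series in the coordinates of
  \<open>x - p\<close>. The multi-indices are the functions \<open>\<alpha>\<close> from the coordinate basis to the naturals,
  extended by \<^const>\<open>undefined\<close> off the basis. As \<open>S\<close> is required to contain a ball around each
  of its points, the values of \<open>f\<close> off \<open>S\<close> are irrelevant.
\<close>

definition real_analytic_on ::
  "('a::euclidean_space \<Rightarrow> 'b::real_normed_vector) \<Rightarrow> 'a set \<Rightarrow> bool" where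
  "real_analytic_on f S \<longleftrightarrow>
    (\<forall>p\<in>S. \<exists>e>0. ball p e \<subseteq> S \<and>
      (\<exists>c :: ('a \<Rightarrow> nat) \<Rightarrow> 'b. \<forall>x\<in>ball p e.
        ((\<lambda>\<alpha>. (\<Prod>b\<in>Basis. ((x - p) \<bullet> b) ^ \<alpha> b) *\<^sub>R c \<alpha>) has_sum f x)
          (Basis \<rightarrow>\<^sub>E UNIV)))"

definition real_analytic_diffeo ::
  "('a::euclidean_space \<Rightarrow> 'b::euclidean_space) \<Rightarrow> 'a set \<Rightarrow> 'b set \<Rightarrow> bool" where
  "real_analytic_diffeo f U V \<longleftrightarrow> open U \<and> open V \<and> bij_betw f U V \<and>
    real_analytic_on f U \<and> real_analytic_on (the_inv_into U f) V"

text \<open>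
  Real-analytic diffeomorphism from a set \<open>M\<close>, whose analytic structure is given by the global
  chart \<open>h\<close> onto the open set \<open>U\<close>, onto an open set \<open>V\<close>.
\<close>

definition real_analytic_diffeo_in_chart ::
  "('m \<Rightarrow> 'a::euclidean_space) \<Rightarrow> 'a set \<Rightarrow> ('m \<Rightarrow> 'b::euclidean_space) \<Rightarrow> 'm set \<Rightarrow> 'b set \<Rightarrow> bool"
  where
  "real_analytic_diffeo_in_chart h U f M V \<longleftrightarrow>
    bij_betw h M U \<and> bij_betw f M V \<and> real_analytic_diffeo (f \<circ> the_inv_into M h) U V"

end

theory Submission
  imports Defs "HOL-Complex_Analysis.Cauchy_Integral_Formula"
begin

text \<open>
  A loxodromic element has two fixed points, hence two eigenvectors, and is therefore conjugate to a
  diagonal matrix (\<open>eigenbasis\<close>). Its eigenvalues have reciprocal norms. They do not both have norm one: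
  otherwise the transformation would preserve the quotient of the distances to the two fixed points, and
  nothing would be attracted (\<open>attracting_eigenvalue_norm_neq\<close>). Writing the eigenvalues in polar form
  gives the normal form with parameters \<open>(r, \<theta>, \<phi>)\<close>, and since all imaginary units are conjugate, the
  parameters determine the conjugacy class (\<open>lox_normal_form_conj\<close>).

  Conversely, let \<open>c = cos \<theta>\<close> and \<open>s = cos \<phi>\<close>. The traces \<open>x\<close> of \<open>A\<close> and \<open>y\<close> of its inverse, and
  \<open>z = r\<^sup>2 + 1 / r\<^sup>2\<close>, satisfy \<open>(x + y) / sqrt (z + 2) = c + s\<close> and \<open>(x - y) / sqrt (z - 2) = c - s\<close>. So the
  parameters can be read off from \<open>(x, y, z)\<close> by an explicit formula, and the region \<open>D_region\<close> consists
  of the triples for which this formula yields cosines strictly between -1 and 1. With the trace of the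
  square instead of \<open>z\<close>, it remains to recover \<open>z\<close>. That trace equals
  \<open>2 x\<^sup>2 - z - (x + y)\<^sup>2 / (z + 2) + (x - y)\<^sup>2 / (z - 2)\<close>, which is strictly decreasing in \<open>z\<close> on the
  relevant range, because \<open>(x + y)\<^sup>2 \<le> 4 (z + 2)\<close> there (\<open>nu_determined\<close>). Since the real part of the trace
  is invariant under conjugation, this also shows that the parameters are well defined.

  Both the formula for the traces and its inverse are compositions of sums, products, quotients, square
  roots, cosines and inverse cosines. They are real analytic because germs of power series in several
  variables are closed under these operations (\<open>analytic_germ_compose_holomorphic\<close>).
\<close>

section \<open>Multiplicativity of the Dieudonne determinant\<close>

definition mat2 :: "'a \<Rightarrow> 'a \<Rightarrow> 'a \<Rightarrow> 'a \<Rightarrow> 'a::zero^2^2"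
  where "mat2 a b c d = vector [vector [a, b], vector [c, d]]"

lemma mat2_nth [simp]:
  "mat2 a b c d $ 1 $ 1 = a" "mat2 a b c d $ 1 $ 2 = b"
  "mat2 a b c d $ 2 $ 1 = c" "mat2 a b c d $ 2 $ 2 = d"
  by (simp_all add: mat2_def)

lemma mat2_cases [cases type]:
  fixes A :: "'a::zero^2^2" obtains a b c d where "A = mat2 a b c d"
  using that[of "A$1$1" "A$1$2" "A$2$1" "A$2$2"] by (simp add: vec_eq_iff forall_2)

lemma mat2_eq_iff [simp]: "mat2 a b c d = mat2 a' b' c' d' \<longleftrightarrow> a = a' \<and> b = b' \<and> c = c' \<and> d = d'"
  by (auto simp: vec_eq_iff forall_2)

lemma mat2_mult:
  "mat2 a b c d ** mat2 a' b' c' d' =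
    mat2 (a * a' + b * c') (a * b' + b * d') (c * a' + d * c') (c * b' + d * d' :: 'a::semiring_1)"
  by (simp add: vec_eq_iff forall_2 matrix_matrix_mult_def sum_2)

lemma mat_1_eq_mat2: "mat 1 = mat2 1 0 0 (1::'a::semiring_1)"
  by (simp add: vec_eq_iff forall_2 mat_def)

lemma diag2_eq_mat2: "diag2 a d = mat2 a 0 0 d"
  by (simp add: diag2_def mat2_def)

lemma Dieudonne_det_mat2:
  "Dieudonne_det (mat2 a b c d) = (if a \<noteq> 0 then norm a * norm (d - c * inverse a * b) else norm c * norm b)"
proof -
  have "a * d - a * c * inverse a * b = a * (d - c * inverse a * b)"
    by (simp add: algebra_simps)
  then show ?thesis by (simp add: Dieudonne_det_def Let_def norm_mult)
qed

text \<open>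
  Multiplicativity is checked on three kinds of left factors, because every invertible matrix is a
  product of such factors and the defining formula transforms visibly under each of them.
\<close>

lemma Dieudonne_det_lower_mult: "Dieudonne_det (mat2 1 0 x 1 ** B) = Dieudonne_det B"
proof (cases B)
  case (1 a b c d)
  have "a \<noteq> 0 \<Longrightarrow> (x * a + c) * inverse a * b = x * b + c * inverse a * b"
    by (simp add: distrib_right mult.assoc)
  with 1 show ?thesis by (simp add: mat2_mult Dieudonne_det_mat2)
qed

lemma Dieudonne_det_swap_mult: "Dieudonne_det (mat2 0 1 1 0 ** B) = Dieudonne_det B"
proof (cases B)
  case (1 a b c d)
  have "norm c * norm (b - a * inverse c * d) = norm a * norm (d - c * inverse a * b)"
    if "a \<noteq> 0" "c \<noteq> 0"
  proof -
    have "b - a * inverse c * d = a * (inverse a * b - inverse c * d)"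
      and "d - c * inverse a * b = - (c * (inverse a * b - inverse c * d))"
      using that by (simp_all add: right_diff_distrib flip: mult.assoc)
    then show ?thesis by (simp only: norm_minus_cancel norm_mult mult_ac)
  qed
  with 1 show ?thesis by (simp add: mat2_mult Dieudonne_det_mat2)
qed

lemma Dieudonne_det_diag2_mult: "Dieudonne_det (diag2 x y ** B) = norm x * norm y * Dieudonne_det B"
proof (cases B)
  case (1 a b c d)
  have "y * d - y * c * inverse (x * a) * (x * b) = y * (d - c * inverse a * b)" if "a \<noteq> 0" "x \<noteq> 0"
  proof -
    have "inverse (x * a) * (x * b) = inverse a * b"
      using that by (simp add: nonzero_inverse_mult_distrib mult.assoc) (simp flip: mult.assoc)
    then show ?thesis by (simp add: right_diff_distrib mult.assoc)
  qed
  with 1 show ?thesis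
    by (auto simp: diag2_eq_mat2 mat2_mult Dieudonne_det_mat2 norm_mult)
qed

text \<open>
  Gaussian elimination over a division ring; \<open>d - c a\<inverse> b\<close> is the Schur complement of the corner
  entry, whose norm occurs in the Dieudonne determinant.
\<close>

lemma mat2_LDU:
  fixes a :: "'a::division_ring"
  assumes "a \<noteq> 0"
  shows "mat2 a b c d = mat2 1 0 (c * inverse a) 1 ** (mat2 a 0 0 (d - c * inverse a * b) ** mat2 1 (inverse a * b) 0 1)"
  using assms by (simp add: mat2_mult mult.assoc) (simp flip: mult.assoc)

lemma Dieudonne_det_upper_mult: "Dieudonne_det (mat2 1 x 0 1 ** B) = Dieudonne_det B"
proof -
  have "mat2 1 x 0 1 = mat2 0 1 1 0 ** (mat2 1 0 x 1 ** mat2 0 1 1 0)"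
    by (simp add: mat2_mult)
  then show ?thesis
    by (simp only: Dieudonne_det_swap_mult Dieudonne_det_lower_mult flip: matrix_mul_assoc)
qed

lemma invertible_first_column: "invertible (mat2 a b c d) \<Longrightarrow> a \<noteq> 0 \<or> c \<noteq> (0 :: 'a::semiring_1)"
proof (rule ccontr)
  assume "invertible (mat2 a b c d)" and z: "\<not> (a \<noteq> 0 \<or> c \<noteq> 0)"
  then obtain B where "B ** mat2 a b c d = mat 1" by (auto simp: invertible_def)
  with z show False by (cases B) (auto simp: mat2_mult mat_1_eq_mat2)
qed

text \<open>
  Eliminate in the left factor. If its corner entry vanishes, the entry below does not, and
  exchanging the rows, which preserves the determinant, restores a nonzero corner.
\<close>

lemma Dieudonne_det_mult:
  assumes "invertible A"
  shows "Dieudonne_det (A ** B) = Dieudonne_det A * Dieudonne_det B"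
proof -
  have nz: "Dieudonne_det (mat2 a b c d ** B) = Dieudonne_det (mat2 a b c d) * Dieudonne_det B" if "a \<noteq> 0" for a b c d
    by (subst mat2_LDU[OF that])
      (simp add: that Dieudonne_det_mat2 Dieudonne_det_lower_mult Dieudonne_det_upper_mult
        Dieudonne_det_diag2_mult[unfolded diag2_eq_mat2] flip: matrix_mul_assoc)
  show ?thesis
  proof (cases A)
    case (1 a b c d)
    show ?thesis
    proof (cases "a = 0")
      case True
      then have "c \<noteq> 0" using assms 1 invertible_first_column by blast
      moreover have "A = mat2 0 1 1 0 ** mat2 c d a b" by (simp add: 1 mat2_mult)
      ultimately show ?thesis by (simp add: nz Dieudonne_det_swap_mult flip: matrix_mul_assoc)
    qed (simp add: 1 nz)
  qed
qed

lemma invertible_if_Dieudonne_det_nonzero: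
  assumes "Dieudonne_det A \<noteq> 0" shows "invertible A"
proof -
  have tri: "invertible (mat2 1 0 x 1)" "invertible (mat2 1 x 0 (1::quat))" for x :: quat
    unfolding invertible_def
    by (rule exI[of _ "mat2 1 0 (- x) 1"], simp add: mat2_mult mat_1_eq_mat2)
      (rule exI[of _ "mat2 1 (- x) 0 1"], simp add: mat2_mult mat_1_eq_mat2)
  have diag: "invertible (mat2 x 0 0 y)" if "x \<noteq> 0" "y \<noteq> 0" for x y :: quat
    unfolding invertible_def using that
    by (intro exI[of _ "mat2 (inverse x) 0 0 (inverse y)"]) (simp add: mat2_mult mat_1_eq_mat2)
  have swap: "invertible (mat2 0 1 1 (0::quat))"
    unfolding invertible_def by (rule exI[of _ "mat2 0 1 1 0"]) (simp add: mat2_mult mat_1_eq_mat2)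
  have nz: "invertible (mat2 a b c d)" if "a \<noteq> 0" "Dieudonne_det (mat2 a b c d) \<noteq> 0" for a b c d
    using that by (subst mat2_LDU) (auto simp: Dieudonne_det_mat2 intro!: invertible_mult tri diag)
  show ?thesis
  proof (cases A)
    case (1 a b c d)
    show ?thesis
    proof (cases "a = 0")
      case True
      have "A = mat2 0 1 1 0 ** mat2 c d a b" by (simp add: 1 mat2_mult)
      moreover have "c \<noteq> 0" using assms True 1 by (auto simp: Dieudonne_det_mat2)
      moreover have "Dieudonne_det (mat2 c d a b) \<noteq> 0"
        using assms calculation(1) Dieudonne_det_swap_mult by metis
      ultimately show ?thesis using nz swap invertible_mult by metis
    qed (use assms 1 nz in auto)
  qed
qed

section \<open>Conjugacy in SL(2,H) and its trace invariants\<close>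

lemma matrix_inv_mult:
  fixes A :: "'a::semiring_1^'n^'n"
  assumes "invertible A" shows "A ** matrix_inv A = mat 1" "matrix_inv A ** A = mat 1"
  using someI_ex[OF assms[unfolded invertible_def]] by (simp_all add: matrix_inv_def)

lemma matrix_inv_unique:
  fixes A :: "'a::semiring_1^'n^'n"
  assumes "A ** B = mat 1" "B ** A = mat 1" shows "matrix_inv A = B"
proof -
  have "invertible A" using assms by (auto simp: invertible_def)
  then have "matrix_inv A = matrix_inv A ** (A ** B)"
    using assms by simp
  also have "\<dots> = B"
    using matrix_inv_mult[OF \<open>invertible A\<close>] by (simp add: matrix_mul_assoc)
  finally show ?thesis .
qed

lemma SL2H_iff: "A \<in> SL2H \<longleftrightarrow> Dieudonne_det A = 1"
  by (auto simp: SL2H_def invertible_if_Dieudonne_det_nonzero)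

lemma SL2H_mult: "A \<in> SL2H \<Longrightarrow> B \<in> SL2H \<Longrightarrow> A ** B \<in> SL2H"
  by (simp add: SL2H_def invertible_mult Dieudonne_det_mult)

lemma SL2H_one: "mat 1 \<in> SL2H"
  by (simp add: SL2H_def invertible_def Dieudonne_det_mat2 mat_1_eq_mat2 mat2_mult)
    (metis mat_1_eq_mat2 matrix_mul_lid)

lemma SL2H_inverse_mult:
  assumes "A \<in> SL2H" shows "A ** matrix_inv A = mat 1" "matrix_inv A ** A = mat 1"
  using assms matrix_inv_mult by (auto simp: SL2H_def)

lemma SL2H_inverse: assumes "A \<in> SL2H" shows "matrix_inv A \<in> SL2H"
proof -
  have "invertible (matrix_inv A)"
    using SL2H_inverse_mult[OF assms] by (auto simp: invertible_def)
  moreover have "Dieudonne_det (A ** matrix_inv A) = 1"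
    using SL2H_one by (simp add: SL2H_inverse_mult[OF assms] SL2H_def)
  ultimately show ?thesis
    using assms by (simp add: SL2H_def Dieudonne_det_mult)
qed

lemma SL2H_diag2_iff: "diag2 a d \<in> SL2H \<longleftrightarrow> norm a * norm d = 1"
  by (auto simp: SL2H_iff diag2_eq_mat2 Dieudonne_det_mat2)

text \<open>
  The intertwining relation \<open>A Q = Q B\<close> is easier to produce and to compose than the definition of
  conjugacy: the columns of \<open>Q\<close> are then eigenvectors whenever \<open>B\<close> is diagonal.
\<close>

lemma SL2H_conjI:
  assumes A: "A \<in> SL2H" and Q: "Q \<in> SL2H" and eq: "A ** Q = Q ** B"
  shows "(A, B) \<in> SL2H_conj"
proof -
  have "matrix_inv Q ** A ** Q = (matrix_inv Q ** Q) ** B"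
    by (simp add: eq flip: matrix_mul_assoc)
  then have B: "B = matrix_inv Q ** A ** matrix_inv (matrix_inv Q)"
    using SL2H_inverse_mult[OF Q] matrix_inv_unique[of "matrix_inv Q" Q] by simp
  have "matrix_inv Q ** A ** Q \<in> SL2H"
    by (intro SL2H_mult SL2H_inverse A Q)
  then have "B \<in> SL2H"
    using B SL2H_inverse_mult[OF Q] matrix_inv_unique[of "matrix_inv Q" Q] by simp
  then show ?thesis
    unfolding SL2H_conj_def using A B SL2H_inverse[OF Q] by blast
qed

lemma SL2H_conjE:
  assumes "(A, B) \<in> SL2H_conj"
  obtains P where "A \<in> SL2H" "B \<in> SL2H" "P \<in> SL2H" "B = P ** A ** matrix_inv P" "B ** P = P ** A"
proof -
  from assms obtain P where *: "A \<in> SL2H" "B \<in> SL2H" "P \<in> SL2H" "B = P ** A ** matrix_inv P"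
    by (auto simp: SL2H_conj_def)
  moreover have "B ** P = P ** A"
    using *(4) SL2H_inverse_mult[OF *(3)] by (simp flip: matrix_mul_assoc)
  ultimately show ?thesis by (rule that)
qed

lemma SL2H_conj_refl: "A \<in> SL2H \<Longrightarrow> (A, A) \<in> SL2H_conj"
  by (rule SL2H_conjI[OF _ SL2H_one]) simp_all

lemma SL2H_conj_sym: "(A, B) \<in> SL2H_conj \<Longrightarrow> (B, A) \<in> SL2H_conj"
  by (erule SL2H_conjE) (rule SL2H_conjI)

lemma SL2H_conj_trans:
  assumes "(A, B) \<in> SL2H_conj" "(B, C) \<in> SL2H_conj" shows "(A, C) \<in> SL2H_conj"
proof -
  from SL2H_conj_sym[OF assms(1)] obtain P where P: "A \<in> SL2H" "P \<in> SL2H" "A ** P = P ** B"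
    by (auto elim: SL2H_conjE)
  from SL2H_conj_sym[OF assms(2)] obtain Q where Q: "Q \<in> SL2H" "B ** Q = Q ** C"
    by (auto elim: SL2H_conjE)
  have "A ** (P ** Q) = (P ** Q) ** C"
    using P(3) Q(2) by (metis matrix_mul_assoc)
  then show ?thesis
    using P Q SL2H_mult by (intro SL2H_conjI[of A "P ** Q"])
qed

lemma equiv_SL2H_conj: "equiv SL2H SL2H_conj"
proof (intro equivI refl_onI symI transI)
  show "SL2H_conj \<subseteq> SL2H \<times> SL2H" by (auto simp: SL2H_conj_def)
qed (auto intro: SL2H_conj_refl SL2H_conj_sym SL2H_conj_trans)

text \<open>
  The trace of a quaternionic matrix is not cyclic, but its real part is, since
  \<open>Re (x y) = Re (y x)\<close>. This is the source of all conjugation invariants used below.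
\<close>

lemma tr_mult_commute: "tr (A ** B) = tr (B ** A)"
  by (cases A; cases B) (simp add: tr_def trace_def sum_2 mat2_mult algebra_simps)

lemma tr_conj:
  assumes "(A, B) \<in> SL2H_conj"
  shows "tr B = tr A"
proof -
  from assms obtain P where P: "P \<in> SL2H" "B = P ** A ** matrix_inv P" by (auto elim: SL2H_conjE)
  have "tr (P ** (A ** matrix_inv P)) = tr (A ** (matrix_inv P ** P))"
    by (simp add: tr_mult_commute[of P] flip: matrix_mul_assoc)
  with P show ?thesis by (simp add: SL2H_inverse_mult matrix_mul_assoc)
qed

lemma SL2H_conj_square: assumes "(A, B) \<in> SL2H_conj" shows "(A ** A, B ** B) \<in> SL2H_conj"
proof -
  from SL2H_conj_sym[OF assms] obtain P where P: "A \<in> SL2H" "P \<in> SL2H" "A ** P = P ** B"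
    by (auto elim: SL2H_conjE)
  have "(A ** A) ** P = P ** (B ** B)" using P(3) by (metis matrix_mul_assoc)
  with P show ?thesis by (intro SL2H_conjI[of _ P] SL2H_mult)
qed

lemma SL2H_conj_inverse: assumes "(A, B) \<in> SL2H_conj" shows "(matrix_inv A, matrix_inv B) \<in> SL2H_conj"
proof -
  from SL2H_conj_sym[OF assms] obtain P where P: "A \<in> SL2H" "B \<in> SL2H" "P \<in> SL2H" "A ** P = P ** B"
    by (auto elim: SL2H_conjE)
  have "matrix_inv A ** P = matrix_inv A ** P ** (B ** matrix_inv B)"
    by (simp add: SL2H_inverse_mult[OF P(2)])
  also have "\<dots> = matrix_inv A ** (A ** P) ** matrix_inv B"
    by (simp add: P(4) matrix_mul_assoc)
  also have "\<dots> = P ** matrix_inv B"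
    by (simp add: SL2H_inverse_mult[OF P(1)] matrix_mul_assoc)
  finally show ?thesis
    using P by (intro SL2H_conjI[of _ P] SL2H_inverse)
qed

section \<open>Polar form and conjugacy of quaternions\<close>

lemma quat_of_real_sel [simp]:
  "qRe (of_real r) = r" "qI (of_real r) = 0" "qJ (of_real r) = 0" "qK (of_real r) = 0"
  by (simp_all add: of_real_def)

lemma quat_of_real_commute: "of_real r * x = x * (of_real r :: quat)"
  by (simp add: quat_eq_iff)

lemma norm_quat_sq: "(norm (x::quat))\<^sup>2 = (qRe x)\<^sup>2 + (qI x)\<^sup>2 + (qJ x)\<^sup>2 + (qK x)\<^sup>2"
  unfolding power2_norm_eq_inner by (simp add: inner_quat_def power2_eq_square)

lemma imag_units_iff: "I \<in> imag_units \<longleftrightarrow> qRe I = 0 \<and> norm I = 1"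
proof
  assume "I \<in> imag_units"
  then have sq: "I * I = -1" by (simp add: imag_units_def power2_eq_square)
  then have "norm I * norm I = 1" by (metis norm_minus_cancel norm_mult norm_one)
  then have 1: "norm I = 1" by (simp add: square_eq_1_iff) (use norm_ge_zero[of I] in linarith)
  have "qRe I = 0"
  proof (rule ccontr)
    assume r: "qRe I \<noteq> 0"
    with sq have "qI I = 0" "qJ I = 0" "qK I = 0" by (auto simp: quat_eq_iff)
    with sq have "(qRe I)\<^sup>2 = -1" by (simp add: quat_eq_iff power2_eq_square)
    then show False using zero_le_power2[of "qRe I"] by linarith
  qed
  with 1 show "qRe I = 0 \<and> norm I = 1" by simp
next
  assume I: "qRe I = 0 \<and> norm I = 1"
  then have "(qI I)\<^sup>2 + (qJ I)\<^sup>2 + (qK I)\<^sup>2 = 1" using norm_quat_sq[of I] by simp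
  with I show "I \<in> imag_units"
    by (simp add: imag_units_def power2_eq_square quat_eq_iff)
qed

lemma qRe_qcis: "I \<in> imag_units \<Longrightarrow> qRe (qcis I t) = cos t"
  by (simp add: qcis_def imag_units_iff)

lemma norm_qcis: assumes "I \<in> imag_units" shows "norm (qcis I t) = 1"
proof -
  have 1: "qRe I = 0" "(qI I)\<^sup>2 + (qJ I)\<^sup>2 + (qK I)\<^sup>2 = 1"
    using assms norm_quat_sq[of I] by (simp_all add: imag_units_iff)
  have "(norm (qcis I t))\<^sup>2 = (cos t)\<^sup>2 + ((qI I)\<^sup>2 + (qJ I)\<^sup>2 + (qK I)\<^sup>2) * (sin t)\<^sup>2"
    unfolding norm_quat_sq by (simp add: qcis_def 1 power_mult_distrib algebra_simps)
  then have "(norm (qcis I t))\<^sup>2 = 1" by (simp add: 1)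
  then show ?thesis using norm_ge_zero[of "qcis I t"] by (simp add: power2_eq_1_iff)
qed

lemma quat_polar:
  assumes "q \<noteq> 0"
  obtains I t where "I \<in> imag_units" "t \<in> {0..pi}" "q = of_real (norm q) * qcis I t"
proof -
  define v where "v = q - of_real (qRe q)"
  define I where "I = (if v = 0 then Quat 0 1 0 0 else v /\<^sub>R norm v)"
  have I: "I \<in> imag_units"
  proof (cases "v = 0")
    case False
    have "qRe v = 0" by (simp add: v_def)
    with False show ?thesis by (simp add: I_def imag_units_iff)
  qed (simp add: I_def imag_units_iff norm_quat_def inner_quat_def)
  have vI: "v = norm v *\<^sub>R I" by (simp add: I_def)
  define c where "c = qRe q / norm q"
  have sq: "(norm q)\<^sup>2 = (qRe q)\<^sup>2 + (norm v)\<^sup>2"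
    by (simp add: norm_quat_sq v_def)
  then have "(qRe q)\<^sup>2 \<le> (norm q)\<^sup>2" by simp
  then have c: "\<bar>c\<bar> \<le> 1"
    using assms abs_le_square_iff[of "qRe q" "norm q"] by (simp add: c_def)
  have s: "norm q * sin (arccos c) = norm v"
  proof -
    have "(norm q)\<^sup>2 * c\<^sup>2 = (qRe q)\<^sup>2"
      using assms by (simp add: c_def power_divide)
    then have "(norm q)\<^sup>2 * (1 - c\<^sup>2) = (norm v)\<^sup>2"
      using sq by (simp add: right_diff_distrib)
    then have "sqrt ((norm q)\<^sup>2 * (1 - c\<^sup>2)) = norm v" by simp
    then show ?thesis using c by (simp add: sin_arccos_abs real_sqrt_mult)
  qed
  have "of_real (norm q) * qcis I (arccos c) = of_real (norm q * c) + of_real (norm q * sin (arccos c)) * I"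
    using c quat_of_real_commute[of "sin (arccos c)" I]
    by (simp add: qcis_def distrib_left mult.assoc cos_arccos_abs)
  also have "\<dots> = of_real (qRe q) + norm v *\<^sub>R I"
    using assms unfolding s by (simp add: c_def scaleR_conv_of_real)
  also have "\<dots> = q" using vI by (simp add: v_def)
  finally show ?thesis
    using that[OF I, of "arccos c"] c arccos_bounded[of c] by (auto simp: abs_le_iff)
qed

text \<open>
  For every \<open>x\<close>, the element \<open>x - J x I\<close> intertwines \<open>I\<close> and \<open>J\<close>. If it vanished for all \<open>x\<close>, then
  \<open>x = I\<close> would give \<open>I = - J\<close>, hence \<open>I\<close> would be central, and the centre of the quaternions is real.
\<close>

lemma imag_units_conjugate:
  assumes I: "I \<in> imag_units" and J: "J \<in> imag_units"
  obtains u where "norm u = 1" "J * u = u * I"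
proof -
  have sq: "I * I = -1" "J * J = -1"
    using assms by (simp_all add: imag_units_def power2_eq_square)
  have inter: "J * (x - J * x * I) = (x - J * x * I) * I" for x
  proof -
    have "J * (x - J * x * I) = J * x - (J * J) * (x * I)"
      by (simp add: right_diff_distrib mult.assoc)
    also have "\<dots> = J * x + x * I" by (simp add: sq)
    also have "\<dots> = x * I - J * x * (I * I)" by (simp add: sq)
    also have "\<dots> = (x - J * x * I) * I" by (simp add: left_diff_distrib mult.assoc)
    finally show ?thesis .
  qed
  have "\<exists>x. x - J * x * I \<noteq> 0"
  proof (rule ccontr)
    assume "\<nexists>x. x - J * x * I \<noteq> 0"
    then have all: "x = J * x * I" for x by simp
    have "I = J * (I * I)" using all[of I] by (simp add: mult.assoc)
    then have "I = - J" by (simp add: sq)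
    then have comm: "x * I = I * x" for x
    proof -
      have "x * I = J * x * (I * I)" using all[of x] by (metis mult.assoc)
      also have "\<dots> = I * x" using \<open>I = - J\<close> by (simp add: sq)
      finally show ?thesis .
    qed
    have "qJ I = 0 \<and> qK I = 0" using comm[of "Quat 0 1 0 0"] by (simp add: quat_eq_iff)
    moreover have "qI I = 0" using comm[of "Quat 0 0 1 0"] by (simp add: quat_eq_iff)
    ultimately show False using I norm_quat_sq[of I] by (simp add: imag_units_iff)
  qed
  then obtain x where x: "x - J * x * I \<noteq> 0" by blast
  define w where "w = x - J * x * I"
  have "J * (w /\<^sub>R norm w) = (w /\<^sub>R norm w) * I" using inter[of x] by (simp add: w_def)
  moreover have "norm (w /\<^sub>R norm w) = 1" using x by (simp add: w_def)
  ultimately show ?thesis using that by blast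
qed

lemma qcis_conjugate:
  assumes "I \<in> imag_units" "J \<in> imag_units"
  obtains u where "norm u = 1" "of_real r * qcis I t * u = u * (of_real r * qcis J t)"
proof -
  obtain u where u: "norm u = 1" "I * u = u * J" using imag_units_conjugate[OF assms(2,1)] .
  have "qcis I t * u = u * qcis J t"
    using u(2) by (simp add: qcis_def distrib_left distrib_right mult.assoc)
       (simp add: quat_of_real_commute flip: mult.assoc)
  then have "of_real r * qcis I t * u = u * (of_real r * qcis J t)"
    by (metis mult.assoc quat_of_real_commute)
  with u(1) show ?thesis by (rule that)
qed

section \<open>Diagonal normal forms\<close>

definition lox_diag :: "real \<Rightarrow> real \<Rightarrow> real \<Rightarrow> quat \<Rightarrow> quat \<Rightarrow> quat^2^2"
  where "lox_diag r \<theta> \<phi> I J = diag2 (of_real r * qcis I \<theta>) (of_real (inverse r) * qcis J \<phi>)"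

lemma lox_diag_in_SL2H:
  "r > 0 \<Longrightarrow> I \<in> imag_units \<Longrightarrow> J \<in> imag_units \<Longrightarrow> lox_diag r \<theta> \<phi> I J \<in> SL2H"
  by (simp add: lox_diag_def SL2H_diag2_iff norm_mult norm_qcis del: of_real_inverse)

text \<open>
  Only the angles, not the imaginary directions, survive conjugation: rotate each diagonal entry
  separately by a unit quaternion.
\<close>

lemma lox_diag_conj:
  assumes "r > 0" "I \<in> imag_units" "J \<in> imag_units" "I' \<in> imag_units" "J' \<in> imag_units"
  shows "(lox_diag r \<theta> \<phi> I J, lox_diag r \<theta> \<phi> I' J') \<in> SL2H_conj"
proof -
  obtain u where u: "norm u = 1" "of_real r * qcis I \<theta> * u = u * (of_real r * qcis I' \<theta>)"
    using qcis_conjugate[OF assms(2,4)] .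
  obtain w where w: "norm w = 1"
    "of_real (inverse r) * qcis J \<phi> * w = w * (of_real (inverse r) * qcis J' \<phi>)"
    using qcis_conjugate[OF assms(3,5)] .
  show ?thesis
  proof (rule SL2H_conjI[OF lox_diag_in_SL2H[OF assms(1-3)]])
    show "diag2 u w \<in> SL2H" using u w by (simp add: SL2H_diag2_iff)
    show "lox_diag r \<theta> \<phi> I J ** diag2 u w = diag2 u w ** lox_diag r \<theta> \<phi> I' J'"
      unfolding lox_diag_def diag2_eq_mat2 mat2_mult using u w by simp
  qed
qed

lemma lox_normal_form_conj:
  assumes "lox_normal_form A r \<theta> \<phi>" "lox_normal_form B r \<theta> \<phi>"
  shows "(A, B) \<in> SL2H_conj"
proof -
  obtain I J I' J' where *: "I \<in> imag_units" "J \<in> imag_units" "I' \<in> imag_units" "J' \<in> imag_units"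
    "(A, lox_diag r \<theta> \<phi> I J) \<in> SL2H_conj" "(B, lox_diag r \<theta> \<phi> I' J') \<in> SL2H_conj" "r > 1"
    using assms unfolding lox_normal_form_def lox_diag_def by blast
  then have "(lox_diag r \<theta> \<phi> I J, lox_diag r \<theta> \<phi> I' J') \<in> SL2H_conj"
    by (intro lox_diag_conj) auto
  with * show ?thesis by (meson SL2H_conj_sym SL2H_conj_trans)
qed

lemma lox_normal_form_cong:
  assumes "(A, B) \<in> SL2H_conj" shows "lox_normal_form A r \<theta> \<phi> \<longleftrightarrow> lox_normal_form B r \<theta> \<phi>"
  unfolding lox_normal_form_def using assms by (meson SL2H_conj_sym SL2H_conj_trans)

lemma matrix_inv_diag2:
  "a \<noteq> 0 \<Longrightarrow> d \<noteq> 0 \<Longrightarrow> matrix_inv (diag2 a d) = diag2 (inverse a) (inverse d)"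
  by (rule matrix_inv_unique) (simp_all add: diag2_eq_mat2 mat2_mult mat_1_eq_mat2)

lemma tr_diag2: "tr (diag2 a d) = qRe a + qRe d"
  by (simp add: tr_def trace_def sum_2 diag2_eq_mat2)

lemma qRe_qcis_square: "I \<in> imag_units \<Longrightarrow> qRe (qcis I t * qcis I t) = 2 * (cos t)\<^sup>2 - 1"
proof -
  assume I: "I \<in> imag_units"
  then have "(qI I)\<^sup>2 + (qJ I)\<^sup>2 + (qK I)\<^sup>2 = 1" "qRe I = 0"
    using norm_quat_sq[of I] by (simp_all add: imag_units_iff)
  moreover have "qRe (qcis I t * qcis I t) = (cos t)\<^sup>2 - ((qI I)\<^sup>2 + (qJ I)\<^sup>2 + (qK I)\<^sup>2) * (sin t)\<^sup>2"
    using \<open>qRe I = 0\<close> by (simp add: qcis_def power2_eq_square algebra_simps)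
  ultimately show ?thesis by (simp add: sin_squared_eq)
qed

lemma qRe_inverse_unit: "norm x = 1 \<Longrightarrow> qRe (inverse x) = qRe x"
  by (simp add: inverse_quat_def flip: power2_norm_eq_inner)

text \<open>
  The invariants are evaluated on the diagonal representative. The double angles of the square are
  expressed by cosines, as only the cosines of the angles can be recovered from the traces.
\<close>

lemma lox_normal_form_traces:
  assumes "lox_normal_form A r \<theta> \<phi>"
  shows "tr A = r * cos \<theta> + cos \<phi> / r"
    and "tr (matrix_inv A) = cos \<theta> / r + r * cos \<phi>"
    and "tr (A ** A) = r\<^sup>2 * (2 * (cos \<theta>)\<^sup>2 - 1) + (2 * (cos \<phi>)\<^sup>2 - 1) / r\<^sup>2"
proof -
  obtain I J where *: "I \<in> imag_units" "J \<in> imag_units" "r > 1"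
    "(A, lox_diag r \<theta> \<phi> I J) \<in> SL2H_conj"
    using assms unfolding lox_normal_form_def lox_diag_def by blast
  have nz: "qcis I \<theta> \<noteq> 0" "qcis J \<phi> \<noteq> 0" "of_real r \<noteq> (0::quat)" "r \<noteq> 0"
    using norm_qcis[OF *(1), of \<theta>] norm_qcis[OF *(2), of \<phi>] *(3) by auto
  show "tr A = r * cos \<theta> + cos \<phi> / r"
    using tr_conj[OF *(4)] * by (simp add: lox_diag_def tr_diag2 qRe_qcis divide_inverse mult.commute del: of_real_inverse)
  have inv: "qRe (inverse (of_real s * x)) = qRe x / s" if "norm x = 1" for s x
  proof (cases "s = 0")
    case False
    have "x \<noteq> 0" using that by auto
    with False have "inverse (of_real s * x) = inverse x * of_real (inverse s)"
      by (simp add: nonzero_inverse_mult_distrib)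
    then show ?thesis
      using qRe_inverse_unit[OF that] by (simp add: divide_inverse del: of_real_inverse)
  qed simp
  have "tr (matrix_inv A) = tr (matrix_inv (lox_diag r \<theta> \<phi> I J))"
    using tr_conj[OF SL2H_conj_inverse[OF *(4)]] by simp
  also have "\<dots> = cos \<theta> / r + r * cos \<phi>"
    unfolding lox_diag_def using * nz
    by (subst matrix_inv_diag2) (simp_all add: tr_diag2 inv norm_qcis qRe_qcis divide_inverse del: of_real_inverse)
  finally show "tr (matrix_inv A) = cos \<theta> / r + r * cos \<phi>" .
  have sq: "qRe (of_real s * x * (of_real s * x)) = s\<^sup>2 * qRe (x * x)" for s x
    by (simp add: power2_eq_square algebra_simps)
  have "tr (A ** A) = qRe (of_real r * qcis I \<theta> * (of_real r * qcis I \<theta>))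
      + qRe (of_real (inverse r) * qcis J \<phi> * (of_real (inverse r) * qcis J \<phi>))"
    using tr_conj[OF SL2H_conj_square[OF *(4)]]
    by (simp only: lox_diag_def diag2_eq_mat2 mat2_mult) (simp add: tr_diag2 flip: diag2_eq_mat2)
  then show "tr (A ** A) = r\<^sup>2 * (2 * (cos \<theta>)\<^sup>2 - 1) + (2 * (cos \<phi>)\<^sup>2 - 1) / r\<^sup>2"
    unfolding sq qRe_qcis_square[OF *(1)] qRe_qcis_square[OF *(2)] by (simp add: divide_inverse power_inverse)
qed

section \<open>The one-point compactification near a fixed point\<close>

lemma moebius_mat2:
  "moebius (mat2 a b c d) None = (if c = 0 then None else Some (a * inverse c))"
  "moebius (mat2 a b c d) (Some z) = (if c * z + d = 0 then None else Some ((a * z + b) * inverse (c * z + d)))"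
  by (simp_all add: moebius_def)

lemma continuous_on_Quat: "continuous_on UNIV (\<lambda>(a, b, c, d). Quat a b c d)"
proof -
  have "(\<lambda>(a, b, c, d). Quat a b c d) =
      (\<lambda>v. fst v *\<^sub>R 1 + fst (snd v) *\<^sub>R Quat 0 1 0 0 + fst (snd (snd v)) *\<^sub>R Quat 0 0 1 0 +
        snd (snd (snd v)) *\<^sub>R Quat 0 0 0 1)"
    by (auto simp: fun_eq_iff quat_eq_iff)
  then show ?thesis by (auto intro!: continuous_intros)
qed

text \<open>
  The neighbourhoods of infinity are the complements of compact sets, so closed balls must be known
  to be compact. Compactness is transported from boxes in a product of four real lines.
\<close>

lemma compact_cball_quat: "compact (cball v R :: quat set)"
proof -
  define B where "B = {-(norm v + R)..norm v + R}"
  define K where "K = (\<lambda>(a, b, c, d). Quat a b c d) ` (B \<times> B \<times> B \<times> B)"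
  have "compact (B \<times> B \<times> B \<times> B)" by (auto simp: B_def intro: compact_Times)
  from compact_continuous_image[OF continuous_on_subset[OF continuous_on_Quat subset_UNIV] this]
  have "compact K" by (simp add: K_def)
  moreover have "cball v R \<subseteq> K"
  proof
    fix x assume "x \<in> cball v R"
    then have n: "norm x \<le> norm v + R"
      using norm_triangle_sub[of x v] by (simp add: dist_norm norm_minus_commute)
    have sq: "(norm x)\<^sup>2 = (qRe x)\<^sup>2 + (qI x)\<^sup>2 + (qJ x)\<^sup>2 + (qK x)\<^sup>2" by (rule norm_quat_sq)
    have "\<bar>qRe x\<bar> \<le> norm x" "\<bar>qI x\<bar> \<le> norm x" "\<bar>qJ x\<bar> \<le> norm x" "\<bar>qK x\<bar> \<le> norm x"
      by (rule power2_le_imp_le; simp add: sq)+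
    with n have "qRe x \<in> B" "qI x \<in> B" "qJ x \<in> B" "qK x \<in> B"
      by (auto simp: B_def)
    then show "x \<in> K"
      unfolding K_def by (intro image_eqI[of _ _ "(qRe x, qI x, qJ x, qK x)"]) auto
  qed
  ultimately show ?thesis
    using compact_Int_closed[of K "cball v R"] by (simp add: Int_absorb1)
qed

lemma openin_Hhat_Some: "openin Hhat V \<Longrightarrow> open {z. Some z \<in> V}"
  using openin_continuous_map_preimage[OF continuous_map_Some[of "euclidean :: quat topology"]]
  by (simp add: Hhat_def)

lemma openin_Hhat_image_Some: "open U \<Longrightarrow> openin Hhat (Some ` U)"
  by (simp add: Hhat_def)

lemma openin_Hhat_None:
  assumes "openin Hhat V" "None \<in> V"
  obtains R where "\<And>z. norm z > R \<Longrightarrow> Some z \<in> V"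
proof -
  obtain C where "compact C" "V = insert None (Some ` (- C))"
    using assms by (auto simp: Hhat_def openin_Alexandroff_compactification)
  moreover from this obtain R where "\<And>z. z \<in> C \<Longrightarrow> norm z \<le> R"
    using compact_imp_bounded bounded_iff by metis
  ultimately show ?thesis using that[of R] by force
qed

lemma openin_Hhat_outside: "openin Hhat (insert None (Some ` (- cball v R)))"
  unfolding Hhat_def openin_Alexandroff_compactification
  using compact_cball_quat[of v R] by (intro disjI2 exI[of _ "cball v R"]) auto

lemma openin_Hhat_not_singleton:
  assumes "openin Hhat U" "p \<in> U" obtains z where "z \<in> U" "z \<noteq> p"
proof (cases p)
  case None
  with assms obtain R where R: "\<And>z. norm z > R \<Longrightarrow> Some z \<in> U" by (metis openin_Hhat_None)
  have "Some (of_real (\<bar>R\<bar> + 1)) \<in> U" by (rule R) simp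
  then show ?thesis using that None by blast
next
  case (Some u)
  have "open {z. Some z \<in> U}" by (rule openin_Hhat_Some) fact
  then have "{z. Some z \<in> U} \<noteq> {u}" using not_open_singleton by metis
  then show ?thesis using assms that Some by blast
qed

text \<open>
  For an affine fixed point \<open>u\<close> and a vector \<open>(x, y)\<close> representing a point of projective space, the
  homogeneous function \<open>|x - u y|\<close> is multiplied by a constant under a matrix whose action fixes \<open>u\<close>;
  if infinity is fixed, the same holds for \<open>|y|\<close>. The function below is this quantity at the representative \<open>(z, 1)\<close> or
  \<open>(1, 0)\<close>. Only quotients for two base points are independent of the representative.
\<close>

fun chord :: "quat option \<Rightarrow> quat option \<Rightarrow> real" where
  "chord None None = 0"
| "chord None (Some z) = 1"
| "chord (Some u) None = 1"
| "chord (Some u) (Some z) = norm (z - u)"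

lemma chord_nonneg: "0 \<le> chord p z"
  by (cases "(p, z)" rule: chord.cases) auto

lemma chord_eq_0_iff: "chord p z = 0 \<longleftrightarrow> p = z"
  by (cases "(p, z)" rule: chord.cases) auto

text \<open>
  The quotient \<open>chord p / chord q\<close> tends to zero at \<open>p\<close>; it is written without division because
  \<open>chord q\<close> vanishes at \<open>q\<close>.
\<close>

lemma chord_ratio_nhd:
  assumes "p \<noteq> q" "\<epsilon> > 0"
  obtains V where "openin Hhat V" "p \<in> V" "\<And>w. w \<in> V \<Longrightarrow> chord p w < \<epsilon> * chord q w"
proof (cases p)
  case None
  with assms obtain v where v: "q = Some v" by (cases q) auto
  show ?thesis
  proof (rule that[OF openin_Hhat_outside[of v "1 / \<epsilon>"]])
    show "p \<in> insert None (Some ` (- cball v (1 / \<epsilon>)))" using None by simp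
    show "chord p w < \<epsilon> * chord q w" if "w \<in> insert None (Some ` (- cball v (1 / \<epsilon>)))" for w
      using that assms None v by (auto simp: dist_norm norm_minus_commute field_simps)
  qed
next
  case (Some u)
  have "open {w. norm (w - u) < \<epsilon> * chord q (Some w)}"
  proof (cases q)
    case (Some v)
    then show ?thesis by (auto intro!: open_Collect_less continuous_intros)
  qed (auto intro!: open_Collect_less continuous_intros)
  from openin_Hhat_image_Some[OF this] show ?thesis
  proof (rule that)
    have "chord q p > 0" using assms chord_nonneg[of q p] chord_eq_0_iff[of q p] by auto
    then show "p \<in> Some ` {w. norm (w - u) < \<epsilon> * chord q (Some w)}" using Some assms by auto
  qed (auto simp: Some)
qed

text \<open>
  If \<open>f\<close> preserved the quotient \<open>chord p / chord q\<close>, the quotient would be constant along orbits,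
  whereas along an orbit converging to \<open>p\<close> it tends to zero.
\<close>

lemma attracting_chord_not_preserved:
  assumes "attracting f p" "p \<noteq> q"
  obtains z where "chord p (f z) * chord q z \<noteq> chord q (f z) * chord p z"
proof (rule ccontr)
  assume "\<not> thesis"
  then have inv: "chord p (f z) * chord q z = chord q (f z) * chord p z" for z using that by blast
  have ratio: "chord p ((f ^^ n) z) * chord q z = chord q ((f ^^ n) z) * chord p z" for n z
  proof (induction n)
    case (Suc n)
    let ?w = "(f ^^ n) z"
    have pq: "chord p ?w \<noteq> 0 \<or> chord q ?w \<noteq> 0" using assms(2) by (auto simp: chord_eq_0_iff)
    show ?case
    proof (cases "chord q ?w = 0")
      case True
      with pq Suc have "chord q z = 0" by simp
      moreover have "chord q (f ?w) = 0" using inv[of ?w] True pq by simp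
      ultimately show ?thesis by simp
    next
      case False
      have "chord q ?w * (chord p (f ?w) * chord q z) = chord q (f ?w) * (chord p ?w * chord q z)"
        using inv[of ?w] by (simp add: mult_ac)
      also have "\<dots> = chord q ?w * (chord q (f ?w) * chord p z)"
        using Suc by (simp add: mult_ac)
      finally show ?thesis using False by simp
    qed
  qed simp
  obtain U where U: "openin Hhat U" "p \<in> U" "\<And>z. z \<in> U \<Longrightarrow> limitin Hhat (\<lambda>n. (f ^^ n) z) p sequentially"
    using assms(1) by (auto simp: attracting_def)
  obtain z where z: "z \<in> U" "z \<noteq> p" using openin_Hhat_not_singleton[OF U(1,2)] .
  have pz: "chord p z > 0" using z chord_nonneg[of p z] chord_eq_0_iff[of p z] by auto
  \<comment> \<open>the summand 1 allows for \<open>z = q\<close>\<close>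
  define \<epsilon> where "\<epsilon> = chord p z / (chord q z + 1)"
  have \<epsilon>: "\<epsilon> > 0" "\<epsilon> * chord q z < chord p z"
    using pz chord_nonneg[of q z] by (auto simp: \<epsilon>_def field_simps)
  obtain V where V: "openin Hhat V" "p \<in> V" "\<And>w. w \<in> V \<Longrightarrow> chord p w < \<epsilon> * chord q w"
    using chord_ratio_nhd[OF assms(2) \<epsilon>(1)] by blast
  have "\<forall>\<^sub>F n in sequentially. (f ^^ n) z \<in> V"
    using U(3)[OF z(1)] V(1,2) by (auto simp: limitin_def)
  then obtain n where "(f ^^ n) z \<in> V" by (auto simp: eventually_sequentially)
  then have less: "chord p ((f ^^ n) z) < \<epsilon> * chord q ((f ^^ n) z)" by (rule V)
  have "chord q ((f ^^ n) z) * chord p z = chord p ((f ^^ n) z) * chord q z" by (simp add: ratio)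
  also have "\<dots> \<le> \<epsilon> * chord q ((f ^^ n) z) * chord q z"
    using less chord_nonneg by (intro mult_right_mono) auto
  finally have "chord q ((f ^^ n) z) * chord p z \<le> chord q ((f ^^ n) z) * (\<epsilon> * chord q z)"
    by (simp add: mult_ac)
  moreover have "chord q ((f ^^ n) z) > 0"
    using le_less_trans[OF chord_nonneg less] zero_less_mult_pos[OF _ \<epsilon>(1)] by blast
  ultimately show False using \<epsilon>(2) by simp
qed

section \<open>Loxodromic elements are diagonalizable\<close>

text \<open>
  A fixed point \<open>u\<close> corresponds to the right eigenvector \<open>(u, 1)\<close>, and the point at infinity to
  \<open>(1, 0)\<close>. This is the eigenvalue of that vector.
\<close>

definition eigenvalue_at :: "quat^2^2 \<Rightarrow> quat option \<Rightarrow> quat" where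
  "eigenvalue_at A p = (case p of None \<Rightarrow> A$1$1 | Some u \<Rightarrow> A$2$1 * u + A$2$2)"

lemma moebius_fixes_None_iff: "moebius (mat2 a b c d) None = None \<longleftrightarrow> c = 0"
  by (simp add: moebius_mat2)

lemma moebius_fixes_Some_iff:
  "moebius (mat2 a b c d) (Some u) = Some u \<longleftrightarrow> c * u + d \<noteq> 0 \<and> a * u + b = u * (c * u + d)"
  by (auto simp: moebius_mat2 mult.assoc dest: arg_cong[where f = "\<lambda>x. x * (c * u + d)"])

text \<open>
  The function \<open>chord p\<close> is the norm of the linear form that vanishes on the eigenvector of \<open>p\<close>. That
  form is a left eigenvector, and pairing it with the eigenvector of the other fixed point \<open>q\<close>
  identifies the norm of its eigenvalue with that of the eigenvalue at \<open>q\<close>. The factor \<open>s\<close> converts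
  the image of the chosen representative of \<open>z\<close> to the chosen representative of the image point.
\<close>

lemma chord_moebius:
  assumes "invertible A" "moebius A p = p" "moebius A q = q" "p \<noteq> q"
  obtains s where "s > 0" "chord p (moebius A z) * s = norm (eigenvalue_at A q) * chord p z"
    "chord q (moebius A z) * s = norm (eigenvalue_at A p) * chord q z"
proof (cases A)
  case A: (1 a b c d)
  define s where "s = (case z of None \<Rightarrow> if c = 0 then norm a else norm c
    | Some z \<Rightarrow> if c * z + d = 0 then norm (a * z + b) else norm (c * z + d))"
  have "s > 0"
  proof (cases z)
    case None
    then show ?thesis using invertible_first_column assms(1) A by (auto simp: s_def)
  next
    case (Some x)
    have "a * x + b \<noteq> 0" if "c * x + d = 0"
    proof
      assume 0: "a * x + b = 0"
      obtain a' b' c' d' where B: "mat2 a' b' c' d' ** A = mat 1"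
        using assms(1) by (metis invertible_def mat2_cases)
      then have e: "a' * b + b' * d = 0" "c' * b + d' * d = 1" "a' * a + b' * c = 1" "c' * a + d' * c = 0"
        by (simp_all add: A mat2_mult mat_1_eq_mat2)
      have "b = - a * x" "d = - c * x" using 0 that by (simp_all add: eq_neg_iff_add_eq_0 add.commute)
      then have "c' * b + d' * d = - ((c' * a + d' * c) * x)" by (simp add: distrib_right mult.assoc)
      then show False using e by simp
    qed
    then show ?thesis by (simp add: s_def Some)
  qed
  have main: "chord p' (moebius A z) * s = norm (eigenvalue_at A q') * chord p' z"
    if p': "moebius A p' = p'" and q': "moebius A q' = q'" and ne: "p' \<noteq> q'" for p' q'
  proof (cases p')
    case None
    with ne obtain v where v: "q' = Some v" by (cases q') auto
    have "c = 0" using p' A None by (simp add: moebius_fixes_None_iff)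
    moreover from this have "d \<noteq> 0" using q' v A by (auto simp: moebius_fixes_Some_iff)
    ultimately show ?thesis
      by (cases z) (auto simp: None v A eigenvalue_at_def moebius_mat2 s_def)
  next
    case (Some u)
    have u: "c * u + d \<noteq> 0" "a * u + b = u * (c * u + d)"
      using p' Some A by (simp_all add: moebius_fixes_Some_iff)
    have k: "norm (a - u * c) = norm (eigenvalue_at A q')"
    proof (cases q')
      case None
      then have "c = 0" using q' A by (simp add: moebius_fixes_None_iff)
      then show ?thesis by (simp add: None eigenvalue_at_def A)
    next
      case v: (Some v)
      have av: "a * v + b = v * (c * v + d)" using q' v A by (simp add: moebius_fixes_Some_iff)
      have "(a - u * c) * (v - u) = (a * v + b) - (a * u + b) - u * c * (v - u)"
        by (simp add: algebra_simps)
      also have "\<dots> = (v - u) * (c * v + d)"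
        unfolding av u(2) by (simp add: algebra_simps)
      finally have "(a - u * c) * (v - u) = (v - u) * (c * v + d)" .
      then have "norm (a - u * c) * norm (v - u) = norm (v - u) * norm (c * v + d)" by (metis norm_mult)
      moreover have "norm (v - u) \<noteq> 0" using ne v Some by auto
      ultimately show ?thesis by (simp add: eigenvalue_at_def v A)
    qed
    \<comment> \<open>the linear form of \<open>p'\<close> applied to the image of \<open>(x, 1)\<close>\<close>
    have lin: "a * x + b - u * (c * x + d) = (a - u * c) * (x - u)" for x
      using u(2) by (simp add: algebra_simps)
    show ?thesis
    proof (cases z)
      case None
      have "(a * inverse c - u) * c = a - u * c" if "c \<noteq> 0"
        using that by (simp add: left_diff_distrib mult.assoc)
      then have "norm (a * inverse c - u) * norm c = norm (a - u * c)" if "c \<noteq> 0"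
        using that by (metis norm_mult)
      then show ?thesis using k by (auto simp: None Some A moebius_mat2 s_def)
    next
      case x: (Some x)
      show ?thesis
      proof (cases "c * x + d = 0")
        case True
        then show ?thesis using lin[of x] k by (simp add: x Some A moebius_mat2 s_def norm_mult)
      next
        case False
        have "((a * x + b) * inverse (c * x + d) - u) * (c * x + d) = (a - u * c) * (x - u)"
          using False lin[of x] by (simp add: left_diff_distrib mult.assoc)
        then have "norm ((a * x + b) * inverse (c * x + d) - u) * norm (c * x + d) = norm (a - u * c) * norm (x - u)"
          by (metis norm_mult)
        then show ?thesis using False k by (simp add: x Some A moebius_mat2 s_def)
      qed
    qed
  qed
  show ?thesis
    using that[OF \<open>s > 0\<close> main main] assms by blast
qed

text \<open>
  The two eigenvectors are the columns of an invertible matrix. Rescaling one of them by a positive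
  real number does not change its eigenvalue, because reals are central, and makes the determinant one.
\<close>

lemma eigenbasis:
  assumes "moebius A p = p" "moebius A q = q" "p \<noteq> q"
  obtains Q where "Q \<in> SL2H" "A ** Q = Q ** diag2 (eigenvalue_at A p) (eigenvalue_at A q)"
proof (cases A)
  case A: (1 a b c d)
  define x y where "x = (\<lambda>p :: quat option. case p of None \<Rightarrow> 1 | Some u \<Rightarrow> u)"
    and "y = (\<lambda>p :: quat option. case p of None \<Rightarrow> (0::quat) | Some u \<Rightarrow> 1)"
  have ev: "a * x p + b * y p = x p * eigenvalue_at A p" "c * x p + d * y p = y p * eigenvalue_at A p"
    if "moebius A p = p" for p
    using that
    by (cases p; simp add: A x_def y_def eigenvalue_at_def moebius_fixes_None_iff moebius_fixes_Some_iff)+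
  have "\<exists>t>0. mat2 (x p) (of_real t * x q) (y p) (of_real t * y q) \<in> SL2H"
  proof -
    define w where "w = x p * y q - x q * y p"
    have w: "w \<noteq> 0" using assms(3) by (cases p; cases q) (auto simp: w_def x_def y_def)
    have "Dieudonne_det (mat2 (x p) (of_real t * x q) (y p) (of_real t * y q)) = t * norm w" if "t > 0" for t
    proof (cases p)
      case None
      with assms(3) show ?thesis using that
        by (cases q) (auto simp: w_def x_def y_def Dieudonne_det_mat2)
    next
      case (Some u)
      have "norm u * norm (of_real t - inverse u * (of_real t * v)) = t * norm (u - v)" if "u \<noteq> 0" for v
      proof -
        have "u * (of_real t - inverse u * (of_real t * v)) = of_real t * (u - v)"
          using that by (simp add: right_diff_distrib quat_of_real_commute flip: mult.assoc)
        then show ?thesis using \<open>t > 0\<close> by (metis abs_of_pos norm_mult norm_of_real)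
      qed
      moreover have "norm u * norm (inverse u * of_real t) = t" if "u \<noteq> 0"
        using that \<open>t > 0\<close> by (simp add: norm_mult norm_inverse)
      ultimately show ?thesis using \<open>t > 0\<close> Some
        by (cases q) (auto simp: w_def x_def y_def Dieudonne_det_mat2 norm_mult norm_inverse)
    qed
    from this[of "1 / norm w"] show ?thesis
      using w by (intro exI[of _ "1 / norm w"]) (simp add: SL2H_iff del: of_real_divide)
  qed
  then obtain t where t: "mat2 (x p) (of_real t * x q) (y p) (of_real t * y q) \<in> SL2H" by blast
  have scale: "f * (of_real t * u) + g * (of_real t * v) = of_real t * (f * u + g * v)" for f g u v :: quat
  proof -
    have swap: "h * (of_real t * z) = of_real t * (h * z)" for h z :: quat
      by (simp only: quat_of_real_commute[of t h, symmetric] flip: mult.assoc)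
    show ?thesis unfolding swap[of f] swap[of g] by (simp only: distrib_left)
  qed
  have "A ** mat2 (x p) (of_real t * x q) (y p) (of_real t * y q) =
      mat2 (x p) (of_real t * x q) (y p) (of_real t * y q) ** diag2 (eigenvalue_at A p) (eigenvalue_at A q)"
    unfolding diag2_eq_mat2 A mat2_mult scale ev[OF assms(1), unfolded A] ev[OF assms(2), unfolded A]
    by (simp only: mat2_eq_iff mult_zero_right add_0_left add_0_right mult.assoc simp_thms)
  with t show ?thesis by (rule that)
qed

lemma attracting_eigenvalue_norm_neq:
  assumes "invertible A" "attracting (moebius A) p" "moebius A q = q" "p \<noteq> q"
  shows "norm (eigenvalue_at A p) \<noteq> norm (eigenvalue_at A q)"
proof
  assume eq: "norm (eigenvalue_at A p) = norm (eigenvalue_at A q)"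
  obtain z where "chord p (moebius A z) * chord q z \<noteq> chord q (moebius A z) * chord p z"
    using attracting_chord_not_preserved[OF assms(2,4)] by blast
  moreover obtain s where s: "s > 0" "chord p (moebius A z) * s = norm (eigenvalue_at A q) * chord p z"
    "chord q (moebius A z) * s = norm (eigenvalue_at A p) * chord q z"
    using chord_moebius[OF assms(1) _ assms(3,4)] assms(2) unfolding attracting_def by blast
  have "s * (chord p (moebius A z) * chord q z) = s * (chord q (moebius A z) * chord p z)"
    using s(2,3) eq by (metis mult.assoc mult.commute)
  ultimately show False using s(1) by simp
qed

text \<open>
  The eigenvalues have reciprocal norms, and attraction excludes that both norms are one. Listing the
  eigenvalue of larger norm first, their polar forms give the parameters.
\<close>

lemma lox_normal_form_exists:
  assumes "loxodromic A" shows "\<exists>r \<theta> \<phi>. lox_normal_form A r \<theta> \<phi>"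
proof -
  from assms obtain p q where A: "A \<in> SL2H" and pq: "p \<noteq> q" "{z. moebius A z = z} = {p, q}"
    "attracting (moebius A) p" by (auto simp: loxodromic_def)
  then have fix_: "moebius A p = p" "moebius A q = q" by blast+
  have main: ?thesis if fp: "moebius A p = p" "moebius A q = q" "p \<noteq> q"
    and less: "norm (eigenvalue_at A q) < norm (eigenvalue_at A p)" for p q
  proof -
    let ?l = "eigenvalue_at A p" and ?m = "eigenvalue_at A q"
    obtain Q where "Q \<in> SL2H" "A ** Q = Q ** diag2 ?l ?m" using eigenbasis[OF fp] .
    then have conj: "(A, diag2 ?l ?m) \<in> SL2H_conj" by (rule SL2H_conjI[OF A])
    then have "diag2 ?l ?m \<in> SL2H" by (auto elim: SL2H_conjE)
    then have prod: "norm ?l * norm ?m = 1" by (simp add: SL2H_diag2_iff)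
    then have m: "norm ?m = inverse (norm ?l)" by (metis inverse_unique)
    have "norm ?l > 1"
    proof (rule ccontr)
      assume "\<not> norm ?l > 1"
      then have "norm ?l * norm ?m < 1 * 1"
        using less by (intro mult_le_less_imp_less) auto
      with prod show False by simp
    qed
    from prod have "?l \<noteq> 0" "?m \<noteq> 0" by auto
    obtain I \<theta> where I: "I \<in> imag_units" "\<theta> \<in> {0..pi}" "?l = of_real (norm ?l) * qcis I \<theta>"
      using quat_polar[OF \<open>?l \<noteq> 0\<close>] .
    obtain J \<phi> where J: "J \<in> imag_units" "\<phi> \<in> {0..pi}" "?m = of_real (norm ?m) * qcis J \<phi>"
      using quat_polar[OF \<open>?m \<noteq> 0\<close>] .
    have "lox_normal_form A (norm ?l) \<theta> \<phi>"
      unfolding lox_normal_form_def using \<open>norm ?l > 1\<close> I J conj m by metis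
    then show ?thesis by blast
  qed
  have "invertible A" using A by (simp add: SL2H_def)
  from attracting_eigenvalue_norm_neq[OF this pq(3) fix_(2) pq(1)]
  show ?thesis using main[OF fix_ pq(1)] main[OF fix_(2,1)] pq(1) by (metis linorder_neqE)
qed

section \<open>Diagonal matrices are loxodromic\<close>

lemma moebius_diag2_iterate:
  assumes "a \<noteq> 0" "d \<noteq> 0"
  shows "(moebius (diag2 a d) ^^ n) None = None"
    and "\<exists>w. (moebius (diag2 a d) ^^ n) (Some z) = Some w \<and> norm w = (norm a / norm d) ^ n * norm z"
proof -
  show "(moebius (diag2 a d) ^^ n) None = None"
    by (induction n) (simp_all add: diag2_eq_mat2 moebius_mat2)
  show "\<exists>w. (moebius (diag2 a d) ^^ n) (Some z) = Some w \<and> norm w = (norm a / norm d) ^ n * norm z"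
  proof (induction n)
    case (Suc n)
    then obtain w where w: "(moebius (diag2 a d) ^^ n) (Some z) = Some w" "norm w = (norm a / norm d) ^ n * norm z"
      by blast
    have "moebius (diag2 a d) (Some w) = Some (a * w * inverse d)"
      using assms by (simp add: diag2_eq_mat2 moebius_mat2)
    moreover have "norm (a * w * inverse d) = (norm a / norm d) ^ Suc n * norm z"
      by (simp only: norm_mult norm_inverse divide_inverse w(2) power_Suc mult_ac)
    ultimately show ?case
      using w(1) by simp
  qed simp
qed

lemma loxodromic_diag2:
  assumes "norm a * norm d = 1" "norm a > 1"
  shows "loxodromic (diag2 a d)"
proof -
  have nz: "a \<noteq> 0" "d \<noteq> 0" using assms by auto
  have "norm d < 1"
  proof (rule ccontr)
    assume "\<not> norm d < 1"
    then have "norm a * 1 \<le> norm a * norm d" by (intro mult_left_mono) auto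
    with assms show False by simp
  qed
  define k where "k = norm a / norm d"
  have k: "k > 1" using assms nz \<open>norm d < 1\<close> by (simp add: k_def)
  have fixed: "{z. moebius (diag2 a d) z = z} = {None, Some 0}"
  proof -
    have fixed_Some: "moebius (diag2 a d) (Some z) = Some z \<longleftrightarrow> z = 0" for z
    proof
      assume "moebius (diag2 a d) (Some z) = Some z"
      then have "a * z = z * d" using nz by (auto simp: diag2_eq_mat2 moebius_fixes_Some_iff)
      then have "norm a * norm z = norm z * norm d" by (metis norm_mult)
      with assms \<open>norm d < 1\<close> show "z = 0" by auto
    qed (use nz in \<open>simp add: diag2_eq_mat2 moebius_mat2\<close>)
    have "moebius (diag2 a d) z = z \<longleftrightarrow> z = None \<or> z = Some 0" for z
    proof (cases z)
      case (Some x)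
      then show ?thesis using fixed_Some[of x] by simp
    qed (simp add: diag2_eq_mat2 moebius_mat2)
    then show ?thesis by (simp add: set_eq_iff)
  qed
  have "attracting (moebius (diag2 a d)) None"
    unfolding attracting_def
  proof (intro conjI exI[of _ "insert None (Some ` (- {0}))"] ballI)
    show "openin Hhat (insert None (Some ` (- {0})))"
      using openin_Hhat_outside[of 0 0] by simp
    fix z :: "quat option" assume z: "z \<in> insert None (Some ` (- {0}))"
    show "limitin Hhat (\<lambda>n. (moebius (diag2 a d) ^^ n) z) None sequentially"
      unfolding limitin_def
    proof (intro conjI allI impI)
      show "None \<in> topspace Hhat" by (simp add: Hhat_def)
      fix V assume V: "openin Hhat V \<and> None \<in> V"
      then obtain R where R: "\<And>w. norm w > R \<Longrightarrow> Some w \<in> V" using openin_Hhat_None by blast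
      show "\<forall>\<^sub>F n in sequentially. (moebius (diag2 a d) ^^ n) z \<in> V"
      proof (cases z)
        case None
        then show ?thesis using V by (simp add: moebius_diag2_iterate(1)[OF nz])
      next
        case (Some x)
        then have "norm x > 0" using z by auto
        obtain N where "R / norm x < k ^ N" using real_arch_pow[OF k] by blast
        then have "R < k ^ N * norm x" using \<open>norm x > 0\<close> by (simp only: pos_divide_less_eq)
        moreover have "k ^ N * norm x \<le> k ^ n * norm x" if "n \<ge> N" for n
          using k that by (intro mult_right_mono power_increasing) auto
        ultimately have "R < k ^ n * norm x" if "n \<ge> N" for n
          using that by (meson less_le_trans)
        then have "\<forall>\<^sub>F n in sequentially. k ^ n * norm x > R"
          by (rule eventually_sequentiallyI)
        then show ?thesis
        proof eventually_elim
          case (elim n)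
          then show ?case using moebius_diag2_iterate(2)[OF nz, of n x] R Some by (auto simp: k_def)
        qed
      qed
    qed
  qed (use fixed in auto)
  moreover have "attracting (moebius (matrix_inv (diag2 a d))) (Some 0)"
    unfolding attracting_def matrix_inv_diag2[OF nz]
  proof (intro conjI exI[of _ "range Some"] ballI)
    have nz': "inverse a \<noteq> 0" "inverse d \<noteq> 0" using nz by auto
    show "moebius (diag2 (inverse a) (inverse d)) (Some 0) = Some 0"
      using nz by (simp add: diag2_eq_mat2 moebius_mat2)
    show "openin Hhat (range Some)" by (rule openin_Hhat_image_Some) simp
    fix z assume "z \<in> range (Some :: quat \<Rightarrow> _)"
    then obtain x where x: "z = Some x" by blast
    show "limitin Hhat (\<lambda>n. (moebius (diag2 (inverse a) (inverse d)) ^^ n) z) (Some 0) sequentially"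
      unfolding limitin_def
    proof (intro conjI allI impI)
      show "Some 0 \<in> topspace Hhat" by (simp add: Hhat_def)
      fix V assume V: "openin Hhat V \<and> Some 0 \<in> V"
      then obtain e where e: "e > 0" "\<And>w. norm w < e \<Longrightarrow> Some w \<in> V"
        using openE[OF openin_Hhat_Some, of V 0] by (auto simp: subset_iff dist_norm)
      have "(\<lambda>n. inverse k ^ n * norm x) \<longlonglongrightarrow> 0 * norm x"
        using k by (intro tendsto_mult LIMSEQ_realpow_zero tendsto_const) (auto simp: inverse_less_1_iff)
      then have "\<forall>\<^sub>F n in sequentially. inverse k ^ n * norm x < e"
        using e(1) by (auto intro: order_tendstoD)
      then show "\<forall>\<^sub>F n in sequentially. (moebius (diag2 (inverse a) (inverse d)) ^^ n) z \<in> V"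
      proof eventually_elim
        case (elim n)
        have "norm (inverse a) / norm (inverse d) = inverse k"
          by (simp add: k_def norm_inverse divide_inverse)
        then show ?case
          using moebius_diag2_iterate(2)[OF nz', of n x] e(2) x elim by auto
      qed
    qed
  qed auto
  moreover have "diag2 a d \<in> SL2H" using assms by (simp add: SL2H_diag2_iff)
  moreover have "None \<noteq> Some (0 :: quat)" by simp
  ultimately show ?thesis
    unfolding loxodromic_def using fixed by blast
qed

section \<open>The parameters as functions of the traces\<close>

definition params_to_traces :: "real \<times> real \<times> real \<Rightarrow> real \<times> real \<times> real" where
  "params_to_traces = (\<lambda>(r, \<theta>, \<phi>).
    (r * cos \<theta> + cos \<phi> / r, cos \<theta> / r + r * cos \<phi>, r\<^sup>2 + inverse (r\<^sup>2)))"

definition traces_to_params :: "real \<times> real \<times> real \<Rightarrow> real \<times> real \<times> real" where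
  "traces_to_params = (\<lambda>(x, y, z).
    ((sqrt (z + 2) + sqrt (z - 2)) / 2,
     arccos (((x + y) / sqrt (z + 2) + (x - y) / sqrt (z - 2)) / 2),
     arccos (((x + y) / sqrt (z + 2) - (x - y) / sqrt (z - 2)) / 2)))"

text \<open>
  In terms of \<open>c = cos \<theta>\<close> and \<open>s = cos \<phi>\<close>, the two traces satisfy \<open>x + y = (c + s) (r + 1/r)\<close> and
  \<open>x - y = (c - s) (r - 1/r)\<close>, while \<open>r + 1/r\<close> and \<open>r - 1/r\<close> are the square roots of \<open>z + 2\<close> and
  \<open>z - 2\<close>. This explains the expressions that define the target region.
\<close>

lemma trace_coordinates:
  fixes r c s :: real
  assumes "r > 1"
  defines "x \<equiv> r * c + s / r" and "y \<equiv> c / r + r * s" and "z \<equiv> r\<^sup>2 + inverse (r\<^sup>2)"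
  shows "z > 2" "sqrt (z + 2) = r + 1 / r" "sqrt (z - 2) = r - 1 / r"
    and "(x + y) / sqrt (z + 2) = c + s" "(x - y) / sqrt (z - 2) = c - s"
proof -
  have z2: "z + 2 = (r + 1 / r)\<^sup>2" "z - 2 = (r - 1 / r)\<^sup>2"
    using assms(1) by (simp_all add: z_def power2_eq_square field_simps)
  have pos: "r - 1 / r > 0" "r + 1 / r > 0"
    using assms(1) by (simp_all add: field_simps less_1_mult add_pos_pos)
  have "z - 2 > 0" unfolding z2 using pos by simp
  then show "z > 2" by simp
  show R: "sqrt (z + 2) = r + 1 / r" and S: "sqrt (z - 2) = r - 1 / r"
    unfolding z2 using pos by simp_all
  have "x + y = (c + s) * (r + 1 / r)" "x - y = (c - s) * (r - 1 / r)"
    by (simp_all add: x_def y_def algebra_simps add_divide_distrib diff_divide_distrib)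
  then show "(x + y) / sqrt (z + 2) = c + s" "(x - y) / sqrt (z - 2) = c - s"
    unfolding R S using pos by simp_all
qed

text \<open>
  The trace of the square is \<open>2 (r\<^sup>2 c\<^sup>2 + s\<^sup>2 / r\<^sup>2) - z\<close>, and the bracket is \<open>x\<^sup>2 - 2 c s\<close> with
  \<open>4 c s = (c + s)\<^sup>2 - (c - s)\<^sup>2\<close>.
\<close>

lemma square_trace_eq:
  fixes r c s :: real
  assumes "r > 1"
  defines "x \<equiv> r * c + s / r" and "y \<equiv> c / r + r * s" and "z \<equiv> r\<^sup>2 + inverse (r\<^sup>2)"
  shows "r\<^sup>2 * (2 * c\<^sup>2 - 1) + (2 * s\<^sup>2 - 1) / r\<^sup>2 =
    2 * x\<^sup>2 - (z + (x + y)\<^sup>2 / (z + 2) - (x - y)\<^sup>2 / (z - 2))"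
    and "(x + y)\<^sup>2 / (z + 2) = (c + s)\<^sup>2"
proof -
  note coords = trace_coordinates(4,5)[OF assms(1), of c s, folded x_def y_def z_def]
  have sq: "(sqrt (z + 2))\<^sup>2 = z + 2" "(sqrt (z - 2))\<^sup>2 = z - 2"
    using trace_coordinates(1)[OF assms(1), folded z_def] by simp_all
  show p: "(x + y)\<^sup>2 / (z + 2) = (c + s)\<^sup>2"
    using arg_cong[OF coords(1), of power2] by (simp add: power_divide sq)
  have m: "(x - y)\<^sup>2 / (z - 2) = (c - s)\<^sup>2"
    using arg_cong[OF coords(2), of power2] by (simp add: power_divide sq)
  have "2 * x\<^sup>2 = 2 * (r\<^sup>2 * c\<^sup>2) + 2 * (s\<^sup>2 / r\<^sup>2) + 4 * c * s"
    using assms(1) by (simp add: x_def power2_eq_square field_simps)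
  then show "r\<^sup>2 * (2 * c\<^sup>2 - 1) + (2 * s\<^sup>2 - 1) / r\<^sup>2 =
    2 * x\<^sup>2 - (z + (x + y)\<^sup>2 / (z + 2) - (x - y)\<^sup>2 / (z - 2))"
    unfolding p m by (simp add: z_def power2_sum power2_diff diff_divide_distrib right_diff_distrib inverse_eq_divide)
qed

text \<open>
  For fixed \<open>x\<close> and \<open>y\<close>, the difference quotient of \<open>z + (x+y)\<^sup>2 / (z+2) - (x-y)\<^sup>2 / (z-2)\<close> between \<open>z\<close> and \<open>z'\<close> is
  \<open>1 - (x+y)\<^sup>2 / ((z+2) (z'+2)) + (x-y)\<^sup>2 / ((z-2) (z'-2))\<close>. It is positive, because
  \<open>(x+y)\<^sup>2 / (z+2)\<close> is at most 4 and \<open>z' + 2\<close> exceeds 4.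
\<close>

lemma nu_determined:
  fixes x y z z' :: real
  assumes z: "z > 2" "z' > 2" and bound: "(x + y)\<^sup>2 / (z + 2) \<le> 4"
    and eq: "z + (x + y)\<^sup>2 / (z + 2) - (x - y)\<^sup>2 / (z - 2) = z' + (x + y)\<^sup>2 / (z' + 2) - (x - y)\<^sup>2 / (z' - 2)"
  shows "z = z'"
proof (rule ccontr)
  assume "z \<noteq> z'"
  define P M where "P = (x + y)\<^sup>2" and "M = (x - y)\<^sup>2"
  have P: "P / (z' + 2) - P / (z + 2) = (z - z') * (P / ((z + 2) * (z' + 2)))"
    and M: "M / (z' - 2) - M / (z - 2) = (z - z') * (M / ((z - 2) * (z' - 2)))"
    using z by (simp_all add: field_simps)
  have "z - z' = (P / (z' + 2) - P / (z + 2)) - (M / (z' - 2) - M / (z - 2))"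
    using eq by (simp add: P_def M_def)
  then have "(z - z') * 1 = (z - z') * (P / ((z + 2) * (z' + 2)) - M / ((z - 2) * (z' - 2)))"
    unfolding P M by (simp only: right_diff_distrib mult_1_right)
  then have "1 = P / ((z + 2) * (z' + 2)) - M / ((z - 2) * (z' - 2))"
    using \<open>z \<noteq> z'\<close> by (simp only: mult_cancel_left) simp
  also have "\<dots> \<le> P / ((z + 2) * (z' + 2))"
    using z by (simp add: M_def)
  also have "\<dots> = P / (z + 2) / (z' + 2)" by simp
  also have "\<dots> \<le> 4 / (z' + 2)"
    using z bound by (intro divide_right_mono) (auto simp: P_def)
  also have "\<dots> < 1" using z by simp
  finally show False by simp
qed

lemma traces_to_params_left_inverse:
  assumes "r > 1" "\<theta> \<in> {0..pi}" "\<phi> \<in> {0..pi}"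
  shows "traces_to_params (params_to_traces (r, \<theta>, \<phi>)) = (r, \<theta>, \<phi>)"
  unfolding traces_to_params_def params_to_traces_def prod.case
    trace_coordinates(4,5)[OF assms(1)]
  unfolding trace_coordinates(2,3)[OF assms(1)]
  using assms by (simp add: arccos_cos)

section \<open>Conjugacy classes of loxodromic elements\<close>

text \<open>
  This both justifies the definite description in the definition of the parameters and gives the
  injectivity of the second trace map. As the three traces are conjugation invariants, they can be
  compared before any invariance of the parameters themselves is known.
\<close>

lemma lox_normal_form_unique:
  assumes A: "lox_normal_form A r \<theta> \<phi>" and B: "lox_normal_form B r' \<theta>' \<phi>'"
    and eq: "trace_sq A = trace_sq B"
  shows "(r, \<theta>, \<phi>) = (r', \<theta>', \<phi>')"
proof -
  have p: "r > 1" "\<theta> \<in> {0..pi}" "\<phi> \<in> {0..pi}" and p': "r' > 1" "\<theta>' \<in> {0..pi}" "\<phi>' \<in> {0..pi}"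
    using A B by (simp_all add: lox_normal_form_def)
  define x y where "x = r * cos \<theta> + cos \<phi> / r" and "y = cos \<theta> / r + r * cos \<phi>"
  have x': "x = r' * cos \<theta>' + cos \<phi>' / r'" and y': "y = cos \<theta>' / r' + r' * cos \<phi>'"
    using eq by (simp_all add: x_def y_def trace_sq_def lox_normal_form_traces[OF A] lox_normal_form_traces[OF B])
  note z = square_trace_eq[OF p(1), of "cos \<theta>" "cos \<phi>", folded x_def y_def]
  note z' = square_trace_eq[OF p'(1), of "cos \<theta>'" "cos \<phi>'", folded x' y']
  have "r\<^sup>2 + inverse (r\<^sup>2) = r'\<^sup>2 + inverse (r'\<^sup>2)"
  proof (rule nu_determined)
    show "r\<^sup>2 + inverse (r\<^sup>2) > 2" "r'\<^sup>2 + inverse (r'\<^sup>2) > 2"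
      using trace_coordinates(1) p(1) p'(1) by blast+
    have "\<bar>cos \<theta> + cos \<phi>\<bar> \<le> 2"
      using abs_cos_le_one[of \<theta>] abs_cos_le_one[of \<phi>] by linarith
    then show "(x + y)\<^sup>2 / (r\<^sup>2 + inverse (r\<^sup>2) + 2) \<le> 4"
      using power_mono[of "\<bar>cos \<theta> + cos \<phi>\<bar>" 2 2] by (simp add: z(2))
    have "2 * x\<^sup>2 - (r\<^sup>2 + inverse (r\<^sup>2) + (x + y)\<^sup>2 / (r\<^sup>2 + inverse (r\<^sup>2) + 2) - (x - y)\<^sup>2 / (r\<^sup>2 + inverse (r\<^sup>2) - 2))
      = 2 * x\<^sup>2 - (r'\<^sup>2 + inverse (r'\<^sup>2) + (x + y)\<^sup>2 / (r'\<^sup>2 + inverse (r'\<^sup>2) + 2) - (x - y)\<^sup>2 / (r'\<^sup>2 + inverse (r'\<^sup>2) - 2))"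
      unfolding z(1)[symmetric] z'(1)[symmetric]
      using eq by (simp add: trace_sq_def lox_normal_form_traces[OF A] lox_normal_form_traces[OF B])
    then show "r\<^sup>2 + inverse (r\<^sup>2) + (x + y)\<^sup>2 / (r\<^sup>2 + inverse (r\<^sup>2) + 2) - (x - y)\<^sup>2 / (r\<^sup>2 + inverse (r\<^sup>2) - 2) =
      r'\<^sup>2 + inverse (r'\<^sup>2) + (x + y)\<^sup>2 / (r'\<^sup>2 + inverse (r'\<^sup>2) + 2) - (x - y)\<^sup>2 / (r'\<^sup>2 + inverse (r'\<^sup>2) - 2)"
      by simp
  qed
  then have "params_to_traces (r, \<theta>, \<phi>) = params_to_traces (r', \<theta>', \<phi>')"
    using x' y' by (simp add: params_to_traces_def flip: x_def y_def)
  then show ?thesis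
    using traces_to_params_left_inverse[OF p] traces_to_params_left_inverse[OF p'] by metis
qed

lemma lox_params_eq:
  assumes "lox_normal_form A r \<theta> \<phi>" shows "lox_params A = (r, \<theta>, \<phi>)"
  unfolding lox_params_def
proof (rule the_equality)
  show "case (r, \<theta>, \<phi>) of (r, \<theta>, \<phi>) \<Rightarrow> lox_normal_form A r \<theta> \<phi>" using assms by simp
  fix t assume "case t of (r, \<theta>, \<phi>) \<Rightarrow> lox_normal_form A r \<theta> \<phi>"
  then show "t = (r, \<theta>, \<phi>)"
    using lox_normal_form_unique[OF _ assms refl] by (cases t) auto
qed

lemma trace_nu_eq:
  assumes "lox_normal_form A r \<theta> \<phi>" shows "trace_nu A = params_to_traces (r, \<theta>, \<phi>)"
  by (simp add: trace_nu_def params_to_traces_def lox_normal_form_traces[OF assms] nu_def lox_params_eq[OF assms])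

lemma lox_normal_form_determined_by_trace_nu:
  assumes A: "lox_normal_form A r \<theta> \<phi>" and B: "lox_normal_form B r' \<theta>' \<phi>'"
    and eq: "trace_nu A = trace_nu B"
  shows "(r, \<theta>, \<phi>) = (r', \<theta>', \<phi>')"
proof -
  have "r > 1" "\<theta> \<in> {0..pi}" "\<phi> \<in> {0..pi}" "r' > 1" "\<theta>' \<in> {0..pi}" "\<phi>' \<in> {0..pi}"
    using A B by (simp_all add: lox_normal_form_def)
  then show ?thesis
    using eq traces_to_params_left_inverse unfolding trace_nu_eq[OF A] trace_nu_eq[OF B] by metis
qed

lemma lox_params_cong:
  assumes "(A, B) \<in> SL2H_conj" shows "lox_params A = lox_params B"
proof -
  have "lox_normal_form A = lox_normal_form B"
    by (intro ext lox_normal_form_cong assms)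
  then show ?thesis by (simp only: lox_params_def)
qed

lemma on_class_eq:
  assumes "A \<in> SL2H" "\<And>B. (A, B) \<in> SL2H_conj \<Longrightarrow> f B = f A"
  shows "on_class f (SL2H_conj `` {A}) = f A"
proof -
  have "f ` (SL2H_conj `` {A}) \<subseteq> {f A}"
    by (rule image_subsetI) (simp add: assms(2))
  moreover have "f A \<in> f ` (SL2H_conj `` {A})"
    by (rule imageI) (simp add: SL2H_conj_refl[OF assms(1)])
  ultimately have "f ` (SL2H_conj `` {A}) = {f A}" by blast
  then show ?thesis by (simp add: on_class_def)
qed

lemma loxodromic_in_SL2H: "loxodromic A \<Longrightarrow> A \<in> SL2H"
  by (simp add: loxodromic_def)

lemma on_class_lox:
  assumes "A \<in> SL2H"
  shows "on_class trace_nu (SL2H_conj `` {A}) = trace_nu A"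
    and "on_class trace_sq (SL2H_conj `` {A}) = trace_sq A"
    and "on_class lox_params (SL2H_conj `` {A}) = lox_params A"
proof -
  have tr: "trace_nu B = trace_nu A" "trace_sq B = trace_sq A" "lox_params B = lox_params A"
    if AB: "(A, B) \<in> SL2H_conj" for B
  proof -
    note eqs = tr_conj[OF AB] tr_conj[OF SL2H_conj_inverse[OF AB]] tr_conj[OF SL2H_conj_square[OF AB]]
      lox_params_cong[OF AB]
    show "trace_nu B = trace_nu A" "trace_sq B = trace_sq A" "lox_params B = lox_params A"
      by (simp_all only: trace_nu_def trace_sq_def nu_def eqs)
  qed
  show "on_class trace_nu (SL2H_conj `` {A}) = trace_nu A"
    "on_class trace_sq (SL2H_conj `` {A}) = trace_sq A"
    "on_class lox_params (SL2H_conj `` {A}) = lox_params A"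
    by (rule on_class_eq[OF assms], erule tr)+
qed

lemma lox_classes_cases:
  assumes "C \<in> lox_classes"
  obtains A r \<theta> \<phi> where "A \<in> SL2H" "loxodromic A" "C = SL2H_conj `` {A}" "lox_normal_form A r \<theta> \<phi>"
  using assms lox_normal_form_exists loxodromic_in_SL2H
  unfolding lox_classes_def by (metis mem_Collect_eq quotientE)

text \<open>
  A function that determines the parameters separates the classes, since matrices with the same
  normal form are conjugate.
\<close>

lemma inj_on_lox_classes:
  assumes "\<And>A. A \<in> SL2H \<Longrightarrow> on_class f (SL2H_conj `` {A}) = f A"
    and "\<And>A B r \<theta> \<phi> r' \<theta>' \<phi>'. lox_normal_form A r \<theta> \<phi> \<Longrightarrow> lox_normal_form B r' \<theta>' \<phi>' \<Longrightarrow> f A = f B \<Longrightarrow>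
      (r, \<theta>, \<phi>) = (r', \<theta>', \<phi>')"
  shows "inj_on (on_class f) lox_classes"
proof (rule inj_onI)
  fix C D assume CD: "C \<in> lox_classes" "D \<in> lox_classes" and eq: "on_class f C = on_class f D"
  obtain A r \<theta> \<phi> where A: "A \<in> SL2H" "C = SL2H_conj `` {A}" "lox_normal_form A r \<theta> \<phi>"
    using lox_classes_cases[OF CD(1)] by metis
  obtain B r' \<theta>' \<phi>' where B: "B \<in> SL2H" "D = SL2H_conj `` {B}" "lox_normal_form B r' \<theta>' \<phi>'"
    using lox_classes_cases[OF CD(2)] by metis
  have "f A = f B" using eq A B assms(1) by metis
  then have "(A, B) \<in> SL2H_conj"
    using assms(2)[OF A(3) B(3)] lox_normal_form_conj[OF A(3)] B(3) by auto
  then show "C = D" using equiv_class_eq[OF equiv_SL2H_conj] A(2) B(2) by simp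
qed

definition regular_params :: "(real \<times> real \<times> real) set"
  where "regular_params = {1<..} \<times> {0<..<pi} \<times> {0<..<pi}"

lemma reg_lox_classes_subset: "reg_lox_classes \<subseteq> lox_classes"
  unfolding reg_lox_classes_def lox_classes_def quotient_def by (auto simp: regular_loxodromic_def)

text \<open>
  Surjectivity needs that each diagonal matrix with \<open>r > 1\<close> is loxodromic in the dynamical sense.
\<close>

lemma bij_betw_lox_params: "bij_betw (on_class lox_params) reg_lox_classes regular_params"
proof (rule bij_betw_imageI)
  have "inj_on (on_class lox_params) lox_classes"
    by (rule inj_on_lox_classes[OF on_class_lox(3)]) (auto simp: lox_params_eq)
  then show "inj_on (on_class lox_params) reg_lox_classes"
    by (rule inj_on_subset) (rule reg_lox_classes_subset)
  show "on_class lox_params ` reg_lox_classes = regular_params"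
  proof (intro equalityI subsetI)
    fix v assume "v \<in> on_class lox_params ` reg_lox_classes"
    then obtain A where A: "regular_loxodromic A" "v = on_class lox_params (SL2H_conj `` {A})"
      by (auto simp: reg_lox_classes_def elim: quotientE)
    then obtain r \<theta> \<phi> where "lox_normal_form A r \<theta> \<phi>" "\<theta> \<in> {0<..<pi}" "\<phi> \<in> {0<..<pi}" "A \<in> SL2H"
      by (auto simp: regular_loxodromic_def loxodromic_in_SL2H)
    moreover from this have "r > 1" by (simp add: lox_normal_form_def)
    ultimately show "v \<in> regular_params"
      using A(2) by (simp add: on_class_lox lox_params_eq regular_params_def)
  next
    fix v assume "v \<in> regular_params"
    then obtain r \<theta> \<phi> where v: "v = (r, \<theta>, \<phi>)" "r > 1" "\<theta> \<in> {0<..<pi}" "\<phi> \<in> {0<..<pi}"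
      by (auto simp: regular_params_def)
    define I where "I = Quat 0 1 0 0"
    have I: "I \<in> imag_units" by (simp add: I_def imag_units_iff norm_quat_def inner_quat_def)
    define A where "A = lox_diag r \<theta> \<phi> I I"
    have A: "A \<in> SL2H" using lox_diag_in_SL2H[of r I I] v I by (simp add: A_def)
    have nf: "lox_normal_form A r \<theta> \<phi>"
      unfolding lox_normal_form_def using v I SL2H_conj_refl[OF A] by (auto simp: A_def lox_diag_def)
    have "loxodromic A"
      unfolding A_def lox_diag_def
      using v I by (intro loxodromic_diag2) (simp_all add: norm_mult norm_qcis del: of_real_inverse)
    then have "regular_loxodromic A" using nf v by (auto simp: regular_loxodromic_def)
    then have "SL2H_conj `` {A} \<in> reg_lox_classes" by (auto simp: reg_lox_classes_def intro: quotientI)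
    moreover have "on_class lox_params (SL2H_conj `` {A}) = v" using A nf v by (simp add: on_class_lox lox_params_eq)
    ultimately show "v \<in> on_class lox_params ` reg_lox_classes" by force
  qed
qed

section \<open>The bijection onto the region of traces\<close>

text \<open>
  With \<open>R = sqrt (z + 2)\<close> and \<open>S = sqrt (z - 2)\<close> one has \<open>R\<^sup>2 - S\<^sup>2 = 4\<close>, so \<open>(R + S) / 2\<close> and \<open>(R - S) / 2\<close> are
  reciprocal; they play the roles of \<open>r\<close> and \<open>1/r\<close>. The two inequalities of the region say that the
  arguments of the inverse cosine lie strictly between -1 and 1.
\<close>

lemma traces_to_params_right_inverse:
  assumes "v \<in> D_region"
  shows "traces_to_params v \<in> regular_params" "params_to_traces (traces_to_params v) = v"
proof -
  obtain x y z where v: "v = (x, y, z)" by (cases v)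
  define R S a b where "R = sqrt (z + 2)" and "S = sqrt (z - 2)" and "a = (x + y) / R" and "b = (x - y) / S"
  have z: "z > 2" and ab: "\<bar>a + b\<bar> < 2" "\<bar>a - b\<bar> < 2"
    using assms by (simp_all add: v D_region_def R_def S_def a_def b_def)
  have R: "R\<^sup>2 = z + 2" "R > 0" and S: "S\<^sup>2 = z - 2" "S > 0"
    using z by (simp_all add: R_def S_def)
  have "R > 2" using z by (simp add: R_def real_less_rsqrt)
  define r where "r = (R + S) / 2"
  have "r > 1" using \<open>R > 2\<close> S by (simp add: r_def)
  have "r * ((R - S) / 2) = 1"
    using R S by (simp add: r_def power2_eq_square algebra_simps)
  then have inv: "inverse r = (R - S) / 2" by (rule inverse_unique)
  have t: "traces_to_params v = (r, arccos ((a + b) / 2), arccos ((a - b) / 2))"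
    by (simp add: v traces_to_params_def r_def a_def b_def R_def S_def)
  show "traces_to_params v \<in> regular_params"
    unfolding t regular_params_def
    using \<open>r > 1\<close> ab arccos_lt_bounded[of "(a + b) / 2"] arccos_lt_bounded[of "(a - b) / 2"]
    by (simp add: abs_less_iff)
  have xy: "R * a = x + y" "S * b = x - y" using R S by (simp_all add: a_def b_def)
  have cos: "cos (arccos ((a + b) / 2)) = (a + b) / 2" "cos (arccos ((a - b) / 2)) = (a - b) / 2"
    using ab by (simp_all add: cos_arccos_abs)
  have "r * ((a + b) / 2) + (a - b) / 2 * inverse r = (R * a + S * b) / 2"
    and "(a + b) / 2 * inverse r + r * ((a - b) / 2) = (R * a - S * b) / 2"
    unfolding inv by (simp_all add: r_def field_simps)
  moreover have "r\<^sup>2 + (inverse r)\<^sup>2 = (R\<^sup>2 + S\<^sup>2) / 2"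
    unfolding inv by (simp add: r_def power2_eq_square field_simps)
  ultimately show "params_to_traces (traces_to_params v) = v"
    unfolding t by (simp add: params_to_traces_def cos xy v R(1) S(1) divide_inverse[of _ r] power_inverse)
qed

lemma params_to_traces_in_D_region:
  assumes "v \<in> regular_params" shows "params_to_traces v \<in> D_region"
proof -
  obtain r \<theta> \<phi> where v: "v = (r, \<theta>, \<phi>)" "r > 1" "\<theta> \<in> {0<..<pi}" "\<phi> \<in> {0<..<pi}"
    using assms by (auto simp: regular_params_def)
  have "\<bar>cos t\<bar> < 1" if "t \<in> {0<..<pi}" for t
    using that cos_monotone_0_pi[of 0 t] cos_monotone_0_pi[of t pi] by auto
  with v have "\<bar>cos \<theta>\<bar> < 1" "\<bar>cos \<phi>\<bar> < 1" by blast+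
  then show ?thesis
    unfolding v D_region_def params_to_traces_def prod.case mem_Collect_eq
      trace_coordinates(4,5)[OF v(2)]
    using trace_coordinates(1)[OF v(2)] by auto
qed

lemma bij_betw_params_to_traces: "bij_betw params_to_traces regular_params D_region"
proof (rule bij_betw_byWitness[where f' = traces_to_params])
  show "\<forall>v\<in>regular_params. traces_to_params (params_to_traces v) = v"
    using traces_to_params_left_inverse by (auto simp: regular_params_def)
qed (use traces_to_params_right_inverse params_to_traces_in_D_region in blast)+

lemma open_D_region: "open D_region"
proof -
  define W where "W = {v :: real \<times> real \<times> real. snd (snd v) > 2}"
  define f where "f = (\<lambda>v :: real \<times> real \<times> real.
    ((fst v + fst (snd v)) / sqrt (snd (snd v) + 2), (fst v - fst (snd v)) / sqrt (snd (snd v) - 2)))"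
  have "open W" unfolding W_def by (intro open_Collect_less continuous_intros)
  have "continuous_on W f"
    unfolding f_def W_def by (intro continuous_intros) auto
  then have "open (W \<inter> f -` {w. \<bar>fst w + snd w\<bar> < 2 \<and> \<bar>fst w - snd w\<bar> < 2})"
  proof (rule continuous_open_preimage[OF _ \<open>open W\<close>])
    show "open {w :: real \<times> real. \<bar>fst w + snd w\<bar> < 2 \<and> \<bar>fst w - snd w\<bar> < 2}"
      by (intro open_Collect_conj open_Collect_less continuous_intros)
  qed
  also have "W \<inter> f -` {w. \<bar>fst w + snd w\<bar> < 2 \<and> \<bar>fst w - snd w\<bar> < 2} = D_region"
    by (auto simp: W_def f_def D_region_def)
  finally show ?thesis .
qed

lemma open_regular_params: "open regular_params"
  unfolding regular_params_def by (intro open_Times) auto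

section \<open>Germs of real-analytic functions of several variables\<close>

text \<open>
  Analytic germs are handled through the Banach algebra of power series that converge absolutely
  on a closed polydisc. The closure properties of real-analytic functions become norm estimates in
  this algebra.
\<close>

definition multi_indices :: "('a::euclidean_space \<Rightarrow> nat) set"
  where "multi_indices = Basis \<rightarrow>\<^sub>E UNIV"

definition mi_power :: "'a::euclidean_space \<Rightarrow> ('a \<Rightarrow> nat) \<Rightarrow> real"
  where "mi_power v \<alpha> = (\<Prod>b\<in>Basis. (v \<bullet> b) ^ \<alpha> b)"

definition mi_degree :: "('a::euclidean_space \<Rightarrow> nat) \<Rightarrow> nat"
  where "mi_degree \<alpha> = (\<Sum>b\<in>Basis. \<alpha> b)"

definition polydisc :: "'a::euclidean_space \<Rightarrow> real \<Rightarrow> 'a set"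
  where "polydisc p \<rho> = {x. \<forall>b\<in>Basis. \<bar>(x - p) \<bullet> b\<bar> \<le> \<rho>}"

text \<open>
  The norm of a power series is the sum of its absolute values at the corner of the polydisc. The
  predicate says that \<open>f\<close> is the sum of a series of norm at most \<open>M\<close>.
\<close>

definition series_bound :: "('a::euclidean_space \<Rightarrow> real) \<Rightarrow> 'a \<Rightarrow> real \<Rightarrow> real \<Rightarrow> bool" where
  "series_bound f p \<rho> M \<longleftrightarrow> (\<exists>c.
     (\<lambda>\<alpha>. \<bar>c \<alpha>\<bar> * \<rho> ^ mi_degree \<alpha>) summable_on multi_indices \<and>
     (\<Sum>\<^sub>\<infinity>\<alpha>\<in>multi_indices. \<bar>c \<alpha>\<bar> * \<rho> ^ mi_degree \<alpha>) \<le> M \<and>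
     (\<forall>x\<in>polydisc p \<rho>. ((\<lambda>\<alpha>. c \<alpha> * mi_power (x - p) \<alpha>) has_sum f x) multi_indices))"

lemma abs_mi_power_le:
  assumes "x \<in> polydisc p \<rho>"
  shows "\<bar>mi_power (x - p) \<alpha>\<bar> \<le> \<rho> ^ mi_degree \<alpha>"
proof -
  have "\<bar>mi_power (x - p) \<alpha>\<bar> = (\<Prod>b\<in>Basis. \<bar>(x - p) \<bullet> b\<bar> ^ \<alpha> b)"
    by (simp add: mi_power_def abs_prod power_abs)
  also have "\<dots> \<le> (\<Prod>b\<in>Basis. \<rho> ^ \<alpha> b)"
    using assms by (intro prod_mono) (auto simp: polydisc_def intro!: power_mono)
  finally show ?thesis
    by (simp add: mi_degree_def power_sum)
qed

lemma center_in_polydisc: "0 \<le> \<rho> \<Longrightarrow> p \<in> polydisc p \<rho>"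
  by (simp add: polydisc_def)

lemma summable_on_comparison_real:
  fixes f g :: "'i \<Rightarrow> real"
  assumes "g summable_on A" "\<And>x. x \<in> A \<Longrightarrow> \<bar>f x\<bar> \<le> g x"
  shows "f summable_on A"
  using Infinite_Sum.abs_summable_on_comparison_test'[of g A f] assms abs_summable_summable[of f A] by simp

text \<open>
  A series of monomials in which the same multi-index may occur many times, even infinitely often,
  can be regrouped into a power series without increasing the norm. Products and infinite sums of
  power series arrive in this redundant form, indexed by pairs.
\<close>

lemma series_boundI:
  fixes f :: "'a::euclidean_space \<Rightarrow> real" and a :: "'j \<Rightarrow> real"
  assumes "\<rho> > 0"
    and g: "g ` J \<subseteq> multi_indices"
    and sum: "(\<lambda>j. \<bar>a j\<bar> * \<rho> ^ mi_degree (g j)) summable_on J"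
    and le: "(\<Sum>\<^sub>\<infinity>j\<in>J. \<bar>a j\<bar> * \<rho> ^ mi_degree (g j)) \<le> M"
    and f: "\<And>x. x \<in> polydisc p \<rho> \<Longrightarrow> ((\<lambda>j. a j * mi_power (x - p) (g j)) has_sum f x) J"
  shows "series_bound f p \<rho> M"
proof -
  define F where "F \<alpha> = {j \<in> J. g j = \<alpha>}" for \<alpha>
  define c where "c \<alpha> = infsum a (F \<alpha>)" for \<alpha>
  have bij: "bij_betw snd (Sigma multi_indices F) J"
    using g by (auto simp: bij_betw_def inj_on_def F_def image_iff)
  have absF: "(\<lambda>j. norm (a j)) summable_on F \<alpha>" for \<alpha>
  proof -
    have "(\<lambda>j. \<bar>a j\<bar> * \<rho> ^ mi_degree (g j)) summable_on F \<alpha>"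
      by (rule summable_on_subset_banach[OF sum]) (auto simp: F_def)
    then have "(\<lambda>j. \<bar>a j\<bar> * \<rho> ^ mi_degree \<alpha>) summable_on F \<alpha>"
      by (rule summable_on_cong[THEN iffD1, rotated]) (auto simp: F_def)
    then show ?thesis
      using \<open>\<rho> > 0\<close> by (simp add: summable_on_cmult_left')
  qed
  have hasF: "(a has_sum c \<alpha>) (F \<alpha>)" for \<alpha>
    unfolding c_def by (rule has_sum_infsum, rule abs_summable_summable, rule absF)
  have hasN: "((\<lambda>j. \<bar>a j\<bar>) has_sum infsum (\<lambda>j. \<bar>a j\<bar>) (F \<alpha>)) (F \<alpha>)" for \<alpha>
    using absF[of \<alpha>] by (auto intro: has_sum_infsum)
  have cle: "\<bar>c \<alpha>\<bar> \<le> infsum (\<lambda>j. \<bar>a j\<bar>) (F \<alpha>)" for \<alpha>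
    unfolding c_def using norm_infsum_bound[OF absF] by simp
  have N: "((\<lambda>\<alpha>. infsum (\<lambda>j. \<bar>a j\<bar>) (F \<alpha>) * \<rho> ^ mi_degree \<alpha>) has_sum
      (\<Sum>\<^sub>\<infinity>j\<in>J. \<bar>a j\<bar> * \<rho> ^ mi_degree (g j))) multi_indices"
  proof (rule has_sum_SigmaD)
    show "((\<lambda>z. \<bar>a (snd z)\<bar> * \<rho> ^ mi_degree (g (snd z))) has_sum
        (\<Sum>\<^sub>\<infinity>j\<in>J. \<bar>a j\<bar> * \<rho> ^ mi_degree (g j))) (Sigma multi_indices F)"
      using has_sum_infsum[OF sum] has_sum_reindex_bij_betw[OF bij, of "\<lambda>j. \<bar>a j\<bar> * \<rho> ^ mi_degree (g j)"]
      by blast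
  next
    fix \<alpha> :: "'a \<Rightarrow> nat"
    show "((\<lambda>y. \<bar>a (snd (\<alpha>, y))\<bar> * \<rho> ^ mi_degree (g (snd (\<alpha>, y)))) has_sum
        infsum (\<lambda>j. \<bar>a j\<bar>) (F \<alpha>) * \<rho> ^ mi_degree \<alpha>) (F \<alpha>)"
      using has_sum_cmult_left[OF hasN[of \<alpha>], of "\<rho> ^ mi_degree \<alpha>"]
      by (rule has_sum_cong[THEN iffD1, rotated]) (auto simp: F_def)
  qed
  have csum: "(\<lambda>\<alpha>. \<bar>c \<alpha>\<bar> * \<rho> ^ mi_degree \<alpha>) summable_on multi_indices"
    using summable_on_comparison_real[OF has_sum_imp_summable[OF N], of "\<lambda>\<alpha>. \<bar>c \<alpha>\<bar> * \<rho> ^ mi_degree \<alpha>"]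
      cle \<open>\<rho> > 0\<close> by (simp add: abs_mult mult_right_mono)
  have "(\<Sum>\<^sub>\<infinity>\<alpha>\<in>multi_indices. \<bar>c \<alpha>\<bar> * \<rho> ^ mi_degree \<alpha>) \<le>
      (\<Sum>\<^sub>\<infinity>j\<in>J. \<bar>a j\<bar> * \<rho> ^ mi_degree (g j))"
    using cle \<open>\<rho> > 0\<close> by (intro has_sum_mono[OF has_sum_infsum[OF csum] N]) (simp add: mult_right_mono)
  moreover have "((\<lambda>\<alpha>. c \<alpha> * mi_power (x - p) \<alpha>) has_sum f x) multi_indices"
    if x: "x \<in> polydisc p \<rho>" for x
  proof (rule has_sum_SigmaD)
    show "((\<lambda>z. a (snd z) * mi_power (x - p) (g (snd z))) has_sum f x) (Sigma multi_indices F)"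
      using f[OF x] has_sum_reindex_bij_betw[OF bij, of "\<lambda>j. a j * mi_power (x - p) (g j)"]
      by blast
  next
    fix \<alpha> :: "'a \<Rightarrow> nat"
    show "((\<lambda>y. a (snd (\<alpha>, y)) * mi_power (x - p) (g (snd (\<alpha>, y)))) has_sum
        c \<alpha> * mi_power (x - p) \<alpha>) (F \<alpha>)"
      using has_sum_cmult_left[OF hasF[of \<alpha>], of "mi_power (x - p) \<alpha>"]
      by (rule has_sum_cong[THEN iffD1, rotated]) (auto simp: F_def)
  qed
  ultimately show ?thesis
    unfolding series_bound_def using csum le by (intro exI[of _ c]) auto
qed


lemma has_sum_product_real:
  fixes f :: "'i \<Rightarrow> real" and g :: "'j \<Rightarrow> real"
  assumes f: "(f has_sum a) A" and g: "(g has_sum b) B"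
  shows "((\<lambda>z. f (fst z) * g (snd z)) has_sum a * b) (A \<times> B)"
proof (rule has_sum_SigmaI)
  have f': "(\<lambda>x. \<bar>f x\<bar>) summable_on A" and g': "(\<lambda>x. \<bar>g x\<bar>) summable_on B"
    using has_sum_imp_summable[OF f] has_sum_imp_summable[OF g]
    by (auto dest: summable_on_iff_abs_summable_on_real[THEN iffD1])
  have "(\<lambda>z. norm (f (fst z) * g (snd z))) summable_on (A \<times> B)"
  proof (rule summable_on_SigmaI)
    show "((\<lambda>y. norm (f (fst (x, y)) * g (snd (x, y)))) has_sum \<bar>f x\<bar> * infsum (\<lambda>y. \<bar>g y\<bar>) B) B" for x
      using has_sum_cmult_right[OF has_sum_infsum[OF g'], of "\<bar>f x\<bar>"] by (simp add: abs_mult)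
    show "(\<lambda>x. \<bar>f x\<bar> * infsum (\<lambda>y. \<bar>g y\<bar>) B) summable_on A"
      by (rule summable_on_cmult_left[OF f'])
  qed auto
  then show "(\<lambda>z. f (fst z) * g (snd z)) summable_on A \<times> B"
    by (rule abs_summable_summable)
  show "((\<lambda>y. f (fst (x, y)) * g (snd (x, y))) has_sum f x * b) B" for x
    using has_sum_cmult_right[OF g, of "f x"] by simp
  show "((\<lambda>x. f x * b) has_sum a * b) A"
    by (rule has_sum_cmult_left[OF f])
qed

lemma series_bound_abs_le:
  assumes f: "series_bound f p \<rho> M" and x: "x \<in> polydisc p \<rho>"
  shows "\<bar>f x\<bar> \<le> M"
proof -
  obtain c where c: "(\<lambda>\<alpha>. \<bar>c \<alpha>\<bar> * \<rho> ^ mi_degree \<alpha>) summable_on multi_indices"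
     "(\<Sum>\<^sub>\<infinity>\<alpha>\<in>multi_indices. \<bar>c \<alpha>\<bar> * \<rho> ^ mi_degree \<alpha>) \<le> M"
     "((\<lambda>\<alpha>. c \<alpha> * mi_power (x - p) \<alpha>) has_sum f x) multi_indices"
    using f x unfolding series_bound_def by blast
  have "norm (f x) \<le> (\<Sum>\<^sub>\<infinity>\<alpha>\<in>multi_indices. \<bar>c \<alpha>\<bar> * \<rho> ^ mi_degree \<alpha>)"
  proof (rule norm_infsum_le[OF c(3) has_sum_infsum[OF c(1)]])
    show "norm (c \<alpha> * mi_power (x - p) \<alpha>) \<le> \<bar>c \<alpha>\<bar> * \<rho> ^ mi_degree \<alpha>" for \<alpha>
      using abs_mi_power_le[OF x] by (simp add: abs_mult mult_left_mono)
  qed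
  then show ?thesis using c(2) by simp
qed

lemma series_bound_shrink:
  assumes f: "series_bound f p \<rho> M" and \<rho>': "0 < \<rho>'" "\<rho>' \<le> \<rho>"
  shows "series_bound f p \<rho>' M"
proof -
  obtain c where c: "(\<lambda>\<alpha>. \<bar>c \<alpha>\<bar> * \<rho> ^ mi_degree \<alpha>) summable_on multi_indices"
     "(\<Sum>\<^sub>\<infinity>\<alpha>\<in>multi_indices. \<bar>c \<alpha>\<bar> * \<rho> ^ mi_degree \<alpha>) \<le> M"
     "\<And>x. x \<in> polydisc p \<rho> \<Longrightarrow> ((\<lambda>\<alpha>. c \<alpha> * mi_power (x - p) \<alpha>) has_sum f x) multi_indices"
    using f unfolding series_bound_def by blast
  have le: "\<bar>c \<alpha>\<bar> * \<rho>' ^ mi_degree \<alpha> \<le> \<bar>c \<alpha>\<bar> * \<rho> ^ mi_degree \<alpha>" for \<alpha>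
    using \<rho>' by (intro mult_left_mono power_mono) auto
  have s: "(\<lambda>\<alpha>. \<bar>c \<alpha>\<bar> * \<rho>' ^ mi_degree \<alpha>) summable_on multi_indices"
    using summable_on_comparison_real[OF c(1), of "\<lambda>\<alpha>. \<bar>c \<alpha>\<bar> * \<rho>' ^ mi_degree \<alpha>"] le \<rho>'
    by (simp add: abs_mult)
  have "polydisc p \<rho>' \<subseteq> polydisc p \<rho>"
    using \<rho>' by (force simp: polydisc_def)
  moreover have "(\<Sum>\<^sub>\<infinity>\<alpha>\<in>multi_indices. \<bar>c \<alpha>\<bar> * \<rho>' ^ mi_degree \<alpha>) \<le> M"
    using infsum_mono[OF s c(1) le] c(2) by simp
  ultimately show ?thesis
    unfolding series_bound_def using s c(3) by blast
qed

lemma series_bound_const: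
  assumes "\<rho> > 0" shows "series_bound (\<lambda>x. k) p \<rho> \<bar>k\<bar>"
  by (rule series_boundI[where J = "{()}" and a = "\<lambda>_. k" and g = "\<lambda>_. \<lambda>b\<in>Basis. 0"])
    (use assms in \<open>auto simp: multi_indices_def mi_degree_def mi_power_def intro!: has_sum_finiteI\<close>)

lemma series_bound_coordinate:
  assumes "\<rho> > 0" "b \<in> Basis" shows "series_bound (\<lambda>x. (x - p) \<bullet> b) p \<rho> \<rho>"
proof -
  have [simp]: "(\<Prod>b'\<in>Basis. ((x - p) \<bullet> b') ^ (if b' = b then 1 else 0)) = (x - p) \<bullet> b" for x
    using assms prod.delta[of Basis b "\<lambda>b'. (x - p) \<bullet> b'"]
    by (simp add: if_distrib[where f="\<lambda>n. _ ^ n"] cong: if_cong)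
  show ?thesis
    by (rule series_boundI[where J = "{()}" and a = "\<lambda>_. 1" and g = "\<lambda>_. \<lambda>b'\<in>Basis. if b' = b then 1 else 0"])
      (use assms in \<open>auto simp: multi_indices_def mi_degree_def mi_power_def intro!: has_sum_finiteI\<close>)
qed

lemma series_bound_mult:
  assumes f: "series_bound f p \<rho> M" and g: "series_bound g p \<rho> N" and "\<rho> > 0"
  shows "series_bound (\<lambda>x. f x * g x) p \<rho> (M * N)"
proof -
  obtain c where c: "(\<lambda>\<alpha>. \<bar>c \<alpha>\<bar> * \<rho> ^ mi_degree \<alpha>) summable_on multi_indices"
     "(\<Sum>\<^sub>\<infinity>\<alpha>\<in>multi_indices. \<bar>c \<alpha>\<bar> * \<rho> ^ mi_degree \<alpha>) \<le> M"
     "\<And>x. x \<in> polydisc p \<rho> \<Longrightarrow> ((\<lambda>\<alpha>. c \<alpha> * mi_power (x - p) \<alpha>) has_sum f x) multi_indices"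
    using f unfolding series_bound_def by blast
  obtain d where d: "(\<lambda>\<alpha>. \<bar>d \<alpha>\<bar> * \<rho> ^ mi_degree \<alpha>) summable_on multi_indices"
     "(\<Sum>\<^sub>\<infinity>\<alpha>\<in>multi_indices. \<bar>d \<alpha>\<bar> * \<rho> ^ mi_degree \<alpha>) \<le> N"
     "\<And>x. x \<in> polydisc p \<rho> \<Longrightarrow> ((\<lambda>\<alpha>. d \<alpha> * mi_power (x - p) \<alpha>) has_sum g x) multi_indices"
    using g unfolding series_bound_def by blast
  define h where "h = (\<lambda>(\<alpha>::'a \<Rightarrow> nat, \<beta>::'a \<Rightarrow> nat). \<lambda>b\<in>Basis. \<alpha> b + \<beta> b)"
  have deg: "mi_degree (h z) = mi_degree (fst z) + mi_degree (snd z)" for z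
    by (simp add: mi_degree_def h_def case_prod_beta sum.distrib)
  have pow: "mi_power v (h z) = mi_power v (fst z) * mi_power v (snd z)" for v z
    by (simp add: mi_power_def h_def case_prod_beta power_add prod.distrib)
  have sum: "((\<lambda>z. \<bar>c (fst z) * d (snd z)\<bar> * \<rho> ^ mi_degree (h z)) has_sum
      (\<Sum>\<^sub>\<infinity>\<alpha>\<in>multi_indices. \<bar>c \<alpha>\<bar> * \<rho> ^ mi_degree \<alpha>) * (\<Sum>\<^sub>\<infinity>\<alpha>\<in>multi_indices. \<bar>d \<alpha>\<bar> * \<rho> ^ mi_degree \<alpha>))
      (multi_indices \<times> multi_indices)"
    using has_sum_product_real[OF has_sum_infsum[OF c(1)] has_sum_infsum[OF d(1)]]
    by (simp add: deg power_add abs_mult mult_ac)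
  show ?thesis
  proof (rule series_boundI[OF \<open>\<rho> > 0\<close>])
    show "h ` (multi_indices \<times> multi_indices) \<subseteq> multi_indices"
      by (auto simp: h_def multi_indices_def)
    show "(\<lambda>z. \<bar>c (fst z) * d (snd z)\<bar> * \<rho> ^ mi_degree (h z)) summable_on multi_indices \<times> multi_indices"
      using sum by (rule has_sum_imp_summable)
    have "0 \<le> (\<Sum>\<^sub>\<infinity>\<alpha>\<in>multi_indices. \<bar>c \<alpha>\<bar> * \<rho> ^ mi_degree \<alpha>)"
         "0 \<le> (\<Sum>\<^sub>\<infinity>\<alpha>\<in>multi_indices. \<bar>d \<alpha>\<bar> * \<rho> ^ mi_degree \<alpha>)"
      using \<open>\<rho> > 0\<close> by (auto intro!: infsum_nonneg)
    then show "(\<Sum>\<^sub>\<infinity>z\<in>multi_indices \<times> multi_indices. \<bar>c (fst z) * d (snd z)\<bar> * \<rho> ^ mi_degree (h z)) \<le> M * N"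
      unfolding infsumI[OF sum] using c(2) d(2) by (intro mult_mono) auto
    show "((\<lambda>z. (c (fst z) * d (snd z)) * mi_power (x - p) (h z)) has_sum f x * g x)
        (multi_indices \<times> multi_indices)" if "x \<in> polydisc p \<rho>" for x
      using has_sum_product_real[OF c(3)[OF that] d(3)[OF that]] by (simp add: pow mult_ac)
  qed
qed

lemma series_bound_add:
  assumes f: "series_bound f p \<rho> M" and g: "series_bound g p \<rho> N" and "\<rho> > 0"
  shows "series_bound (\<lambda>x. f x + g x) p \<rho> (M + N)"
proof -
  obtain c where c: "(\<lambda>\<alpha>. \<bar>c \<alpha>\<bar> * \<rho> ^ mi_degree \<alpha>) summable_on multi_indices"
     "(\<Sum>\<^sub>\<infinity>\<alpha>\<in>multi_indices. \<bar>c \<alpha>\<bar> * \<rho> ^ mi_degree \<alpha>) \<le> M"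
     "\<And>x. x \<in> polydisc p \<rho> \<Longrightarrow> ((\<lambda>\<alpha>. c \<alpha> * mi_power (x - p) \<alpha>) has_sum f x) multi_indices"
    using f unfolding series_bound_def by blast
  obtain d where d: "(\<lambda>\<alpha>. \<bar>d \<alpha>\<bar> * \<rho> ^ mi_degree \<alpha>) summable_on multi_indices"
     "(\<Sum>\<^sub>\<infinity>\<alpha>\<in>multi_indices. \<bar>d \<alpha>\<bar> * \<rho> ^ mi_degree \<alpha>) \<le> N"
     "\<And>x. x \<in> polydisc p \<rho> \<Longrightarrow> ((\<lambda>\<alpha>. d \<alpha> * mi_power (x - p) \<alpha>) has_sum g x) multi_indices"
    using g unfolding series_bound_def by blast
  have le: "\<bar>c \<alpha> + d \<alpha>\<bar> * \<rho> ^ mi_degree \<alpha> \<le> \<bar>c \<alpha>\<bar> * \<rho> ^ mi_degree \<alpha> + \<bar>d \<alpha>\<bar> * \<rho> ^ mi_degree \<alpha>" for \<alpha>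
    using \<open>\<rho> > 0\<close> by (metis abs_triangle_ineq distrib_right less_imp_le mult_right_mono zero_le_power)
  note cd = summable_on_add[OF c(1) d(1)]
  have s: "(\<lambda>\<alpha>. \<bar>c \<alpha> + d \<alpha>\<bar> * \<rho> ^ mi_degree \<alpha>) summable_on multi_indices"
    using summable_on_comparison_real[OF cd, of "\<lambda>\<alpha>. \<bar>c \<alpha> + d \<alpha>\<bar> * \<rho> ^ mi_degree \<alpha>"] le \<open>\<rho> > 0\<close>
    by (simp add: abs_mult)
  have "(\<Sum>\<^sub>\<infinity>\<alpha>\<in>multi_indices. \<bar>c \<alpha> + d \<alpha>\<bar> * \<rho> ^ mi_degree \<alpha>) \<le> M + N"
    using infsum_mono[OF s cd le] c(2) d(2) by (simp add: infsum_add[OF c(1) d(1)])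
  moreover have "((\<lambda>\<alpha>. (c \<alpha> + d \<alpha>) * mi_power (x - p) \<alpha>) has_sum f x + g x) multi_indices"
    if "x \<in> polydisc p \<rho>" for x
    using has_sum_add[OF c(3)[OF that] d(3)[OF that]] by (simp add: algebra_simps)
  ultimately show ?thesis
    unfolding series_bound_def using s by (intro exI[of _ "\<lambda>\<alpha>. c \<alpha> + d \<alpha>"]) auto
qed

lemma series_bound_power:
  assumes "series_bound f p \<rho> M" "\<rho> > 0"
  shows "series_bound (\<lambda>x. f x ^ n) p \<rho> (M ^ n)"
proof (induction n)
  case 0
  show ?case using series_bound_const[OF \<open>\<rho> > 0\<close>, of 1 p] by simp
next
  case (Suc n)
  show ?case using series_bound_mult[OF assms(1) Suc \<open>\<rho> > 0\<close>] by simp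
qed

text \<open>
  Completeness of the algebra: the coefficients of all summands form one absolutely summable family
  of monomials, which is then regrouped.
\<close>

lemma series_bound_sums:
  fixes f :: "nat \<Rightarrow> 'a::euclidean_space \<Rightarrow> real"
  assumes f: "\<And>k. series_bound (f k) p \<rho> (M k)" and M: "M summable_on UNIV" and "\<rho> > 0"
    and F: "\<And>x. x \<in> polydisc p \<rho> \<Longrightarrow> ((\<lambda>k. f k x) has_sum F x) UNIV"
  shows "series_bound F p \<rho> (infsum M UNIV)"
proof -
  obtain c where c: "\<And>k. (\<lambda>\<alpha>. \<bar>c k \<alpha>\<bar> * \<rho> ^ mi_degree \<alpha>) summable_on multi_indices"
     "\<And>k. (\<Sum>\<^sub>\<infinity>\<alpha>\<in>multi_indices. \<bar>c k \<alpha>\<bar> * \<rho> ^ mi_degree \<alpha>) \<le> M k"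
     "\<And>k x. x \<in> polydisc p \<rho> \<Longrightarrow> ((\<lambda>\<alpha>. c k \<alpha> * mi_power (x - p) \<alpha>) has_sum f k x) multi_indices"
  proof -
    have "\<exists>c. \<forall>k. (\<lambda>\<alpha>. \<bar>c k \<alpha>\<bar> * \<rho> ^ mi_degree \<alpha>) summable_on multi_indices \<and>
      (\<Sum>\<^sub>\<infinity>\<alpha>\<in>multi_indices. \<bar>c k \<alpha>\<bar> * \<rho> ^ mi_degree \<alpha>) \<le> M k \<and>
      (\<forall>x\<in>polydisc p \<rho>. ((\<lambda>\<alpha>. c k \<alpha> * mi_power (x - p) \<alpha>) has_sum f k x) multi_indices)"
      using f unfolding series_bound_def by (intro choice allI)
    then show ?thesis using that by blast
  qed
  define N where "N k = (\<Sum>\<^sub>\<infinity>\<alpha>\<in>multi_indices. \<bar>c k \<alpha>\<bar> * \<rho> ^ mi_degree \<alpha>)" for k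
  have N0: "0 \<le> N k" for k
    unfolding N_def using \<open>\<rho> > 0\<close> by (auto intro!: infsum_nonneg)
  have NM: "N k \<le> M k" for k
    using c(2) by (simp add: N_def)
  have Ns: "N summable_on UNIV"
    using summable_on_comparison_real[OF M, of N] N0 NM by simp
  have rows: "((\<lambda>\<alpha>. \<bar>c (fst (k, \<alpha>)) (snd (k, \<alpha>))\<bar> * \<rho> ^ mi_degree (snd (k, \<alpha>))) has_sum N k) multi_indices" for k
    using has_sum_infsum[OF c(1)] by (simp add: N_def)
  have total: "(\<lambda>z. \<bar>c (fst z) (snd z)\<bar> * \<rho> ^ mi_degree (snd z)) summable_on UNIV \<times> multi_indices"
    by (rule summable_on_SigmaI[OF rows Ns]) (use \<open>\<rho> > 0\<close> in auto)
  show ?thesis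
  proof (rule series_boundI[OF \<open>\<rho> > 0\<close> _ total])
    have "((\<lambda>z. \<bar>c (fst z) (snd z)\<bar> * \<rho> ^ mi_degree (snd z)) has_sum infsum N UNIV) (UNIV \<times> multi_indices)"
      by (rule has_sum_SigmaI[OF rows has_sum_infsum[OF Ns] total])
    then show "(\<Sum>\<^sub>\<infinity>z\<in>UNIV \<times> multi_indices. \<bar>c (fst z) (snd z)\<bar> * \<rho> ^ mi_degree (snd z)) \<le> infsum M UNIV"
      using infsum_mono[OF Ns M NM] by (simp add: infsumI)
    fix x assume x: "x \<in> polydisc p \<rho>"
    show "((\<lambda>z. c (fst z) (snd z) * mi_power (x - p) (snd z)) has_sum F x) (UNIV \<times> multi_indices)"
    proof (rule has_sum_SigmaI)
      show "((\<lambda>\<alpha>. c (fst (k, \<alpha>)) (snd (k, \<alpha>)) * mi_power (x - p) (snd (k, \<alpha>))) has_sum f k x) multi_indices" for k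
        using c(3)[OF x] by simp
      show "((\<lambda>k. f k x) has_sum F x) UNIV" by (rule F[OF x])
      have "(\<lambda>z. norm (c (fst z) (snd z) * mi_power (x - p) (snd z))) summable_on UNIV \<times> multi_indices"
        using total
        by (rule summable_on_comparison_real)
          (use abs_mi_power_le[OF x] in \<open>auto simp: abs_mult intro!: mult_left_mono\<close>)
      then show "(\<lambda>z. c (fst z) (snd z) * mi_power (x - p) (snd z)) summable_on UNIV \<times> multi_indices"
        by (rule abs_summable_summable)
    qed
  qed auto
qed

lemma series_bound_power_series:
  assumes f: "series_bound f p \<rho> M" and "\<rho> > 0"
    and b: "summable (\<lambda>n. \<bar>b n\<bar> * M ^ n)"
    and F: "\<And>x. x \<in> polydisc p \<rho> \<Longrightarrow> (\<lambda>n. b n * f x ^ n) sums F x"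
  shows "series_bound F p \<rho> (\<Sum>\<^sub>\<infinity>n. \<bar>b n\<bar> * M ^ n)"
proof (rule series_bound_sums)
  have "0 \<le> M"
    using series_bound_abs_le[OF f center_in_polydisc] \<open>\<rho> > 0\<close> by force
  show "series_bound (\<lambda>x. b n * f x ^ n) p \<rho> (\<bar>b n\<bar> * M ^ n)" for n
    by (intro series_bound_mult series_bound_const series_bound_power f \<open>\<rho> > 0\<close>)
  show "(\<lambda>n. \<bar>b n\<bar> * M ^ n) summable_on UNIV"
    using b \<open>0 \<le> M\<close> by (intro norm_summable_imp_summable_on) (simp add: abs_mult)
  show "((\<lambda>n. b n * f x ^ n) has_sum F x) UNIV" if x: "x \<in> polydisc p \<rho>" for x
  proof (rule norm_summable_imp_has_sum[OF _ F[OF x]])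
    show "summable (\<lambda>n. norm (b n * f x ^ n))"
      using series_bound_abs_le[OF f x]
      by (intro summable_comparison_test'[OF b]) (auto simp: abs_mult power_abs intro!: mult_left_mono power_mono)
  qed
qed (rule \<open>\<rho> > 0\<close>)

text \<open>
  Without its constant term, a series has norm at most \<open>t M\<close> on the polydisc shrunk by the factor
  \<open>t\<close>, as every remaining monomial has positive degree. So a germ vanishing at \<open>p\<close> can be made
  small enough to be inserted into any convergent power series.
\<close>

lemma series_bound_recentre:
  assumes f: "series_bound f p \<rho> M" and "\<rho> > 0" "\<epsilon> > 0"
  obtains \<rho>' where "0 < \<rho>'" "\<rho>' \<le> \<rho>" "series_bound (\<lambda>x. f x - f p) p \<rho>' \<epsilon>"
proof -
  obtain c where c: "(\<lambda>\<alpha>. \<bar>c \<alpha>\<bar> * \<rho> ^ mi_degree \<alpha>) summable_on multi_indices"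
     "(\<Sum>\<^sub>\<infinity>\<alpha>\<in>multi_indices. \<bar>c \<alpha>\<bar> * \<rho> ^ mi_degree \<alpha>) \<le> M"
     "\<And>x. x \<in> polydisc p \<rho> \<Longrightarrow> ((\<lambda>\<alpha>. c \<alpha> * mi_power (x - p) \<alpha>) has_sum f x) multi_indices"
    using f unfolding series_bound_def by blast
  have M: "0 \<le> M"
    using series_bound_abs_le[OF f center_in_polydisc] \<open>\<rho> > 0\<close> by force
  define z :: "'a \<Rightarrow> nat" where "z = (\<lambda>b\<in>Basis. 0)"
  have z: "z \<in> multi_indices" by (simp add: z_def multi_indices_def)
  have pos: "mi_degree \<alpha> > 0" if "\<alpha> \<in> multi_indices" "\<alpha> \<noteq> z" for \<alpha>
  proof (rule ccontr)
    assume "\<not> mi_degree \<alpha> > 0"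
    then have "\<forall>b\<in>Basis. \<alpha> b = 0" by (simp add: mi_degree_def)
    then have "\<alpha> = z"
      using that(1) by (auto simp: z_def multi_indices_def PiE_def extensional_def fun_eq_iff)
    with that show False by simp
  qed
  have pz [simp]: "mi_power v z = 1" for v by (simp add: mi_power_def z_def)
  have p0: "mi_power 0 \<alpha> = 0" if \<alpha>: "\<alpha> \<in> multi_indices" "\<alpha> \<noteq> z" for \<alpha>
    using pos[OF \<alpha>] by (fastforce simp: mi_power_def mi_degree_def power_0_left intro: ccontr sum.neutral)
  have cz: "c z = f p"
  proof -
    have "((\<lambda>\<alpha>. c \<alpha> * mi_power (p - p) \<alpha>) has_sum c z) {z}"
      by (rule has_sum_finiteI) auto
    then have "((\<lambda>\<alpha>. c \<alpha> * mi_power (p - p) \<alpha>) has_sum c z) multi_indices"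
      by (rule has_sum_cong_neutral[THEN iffD1, rotated -1]) (use z p0 in auto)
    with c(3)[OF center_in_polydisc] \<open>\<rho> > 0\<close> show ?thesis
      by (meson has_sum_unique less_imp_le)
  qed
  \<comment> \<open>the summand 1 allows for \<open>M = 0\<close>\<close>
  define t where "t = min 1 (\<epsilon> / (M + 1))"
  have t: "0 < t" "t \<le> 1" "t * M \<le> \<epsilon>"
  proof -
    show "0 < t" "t \<le> 1" using M \<open>\<epsilon> > 0\<close> by (auto simp: t_def)
    have "t * M \<le> \<epsilon> / (M + 1) * M" using M by (intro mult_right_mono) (auto simp: t_def)
    also have "\<dots> \<le> \<epsilon>" using M \<open>\<epsilon> > 0\<close> by (simp add: field_simps)
    finally show "t * M \<le> \<epsilon>" .
  qed
  define a where "a = c(z := 0)"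
  have le: "\<bar>a \<alpha>\<bar> * (t * \<rho>) ^ mi_degree \<alpha> \<le> t * (\<bar>c \<alpha>\<bar> * \<rho> ^ mi_degree \<alpha>)" if "\<alpha> \<in> multi_indices" for \<alpha>
  proof (cases "\<alpha> = z")
    case False
    then have "t ^ mi_degree \<alpha> \<le> t ^ 1"
      using pos[OF that] t by (intro power_decreasing) auto
    then have "t ^ mi_degree \<alpha> * (\<bar>c \<alpha>\<bar> * \<rho> ^ mi_degree \<alpha>) \<le> t * (\<bar>c \<alpha>\<bar> * \<rho> ^ mi_degree \<alpha>)"
      using \<open>\<rho> > 0\<close> by (intro mult_right_mono) auto
    then show ?thesis using False by (simp add: a_def power_mult_distrib mult_ac)
  qed (use t \<open>\<rho> > 0\<close> in \<open>simp add: a_def\<close>)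
  note ct = summable_on_cmult_right[OF c(1), of t]
  have s: "(\<lambda>\<alpha>. \<bar>a \<alpha>\<bar> * (t * \<rho>) ^ mi_degree \<alpha>) summable_on multi_indices"
    using summable_on_comparison_real[OF ct, of "\<lambda>\<alpha>. \<bar>a \<alpha>\<bar> * (t * \<rho>) ^ mi_degree \<alpha>"] le t \<open>\<rho> > 0\<close>
    by (simp add: abs_mult)
  have "(\<Sum>\<^sub>\<infinity>\<alpha>\<in>multi_indices. \<bar>a \<alpha>\<bar> * (t * \<rho>) ^ mi_degree \<alpha>) \<le> \<epsilon>"
  proof -
    have "(\<Sum>\<^sub>\<infinity>\<alpha>\<in>multi_indices. \<bar>a \<alpha>\<bar> * (t * \<rho>) ^ mi_degree \<alpha>)
        \<le> t * (\<Sum>\<^sub>\<infinity>\<alpha>\<in>multi_indices. \<bar>c \<alpha>\<bar> * \<rho> ^ mi_degree \<alpha>)"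
      using infsum_mono[OF s ct le] by (simp add: infsum_cmult_right')
    also have "\<dots> \<le> t * M" using c(2) t by simp
    finally show ?thesis using t by simp
  qed
  moreover have "((\<lambda>\<alpha>. a \<alpha> * mi_power (x - p) \<alpha>) has_sum f x - f p) multi_indices"
    if x: "x \<in> polydisc p (t * \<rho>)" for x
  proof -
    have "t * \<rho> \<le> \<rho>" using t \<open>\<rho> > 0\<close> by simp
    with x have x': "x \<in> polydisc p \<rho>" by (force simp: polydisc_def)
    have "((\<lambda>\<alpha>. if \<alpha> = z then - f p else 0) has_sum - f p) {z}"
      by (rule has_sum_finiteI) auto
    then have "((\<lambda>\<alpha>. if \<alpha> = z then - f p else 0) has_sum - f p) multi_indices"
      by (rule has_sum_cong_neutral[THEN iffD1, rotated -1]) (use z in auto)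
    from has_sum_add[OF c(3)[OF x'] this] show ?thesis
      by (auto elim!: has_sum_cong[THEN iffD1, rotated] simp: a_def cz)
  qed
  ultimately have "series_bound (\<lambda>x. f x - f p) p (t * \<rho>) \<epsilon>"
    unfolding series_bound_def using s by blast
  then show ?thesis using that[of "t * \<rho>"] t \<open>\<rho> > 0\<close> by simp
qed

definition analytic_germ :: "('a::euclidean_space \<Rightarrow> real) \<Rightarrow> 'a \<Rightarrow> bool"
  where "analytic_germ f p \<longleftrightarrow> (\<exists>\<rho>>0. \<exists>M. series_bound f p \<rho> M)"

lemma analytic_germ_common_radius:
  assumes "analytic_germ f p" "analytic_germ g p"
  obtains \<rho> M N where "\<rho> > 0" "series_bound f p \<rho> M" "series_bound g p \<rho> N"
proof -
  obtain \<rho> M \<sigma> N where *: "\<rho> > 0" "series_bound f p \<rho> M" "\<sigma> > 0" "series_bound g p \<sigma> N"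
    using assms by (auto simp: analytic_germ_def)
  then show ?thesis
    using that[of "min \<rho> \<sigma>" M N] series_bound_shrink[OF *(2), of "min \<rho> \<sigma>"]
      series_bound_shrink[OF *(4), of "min \<rho> \<sigma>"] by simp
qed

lemma analytic_germ_const: "analytic_germ (\<lambda>x. k) p"
  unfolding analytic_germ_def using series_bound_const[of 1 k p] zero_less_one by blast

lemma analytic_germ_add:
  "analytic_germ f p \<Longrightarrow> analytic_germ g p \<Longrightarrow> analytic_germ (\<lambda>x. f x + g x) p"
  by (erule (1) analytic_germ_common_radius) (auto simp: analytic_germ_def intro: series_bound_add)

lemma analytic_germ_mult:
  "analytic_germ f p \<Longrightarrow> analytic_germ g p \<Longrightarrow> analytic_germ (\<lambda>x. f x * g x) p"
  by (erule (1) analytic_germ_common_radius) (auto simp: analytic_germ_def intro: series_bound_mult)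

lemma analytic_germ_diff:
  assumes "analytic_germ f p" "analytic_germ g p" shows "analytic_germ (\<lambda>x. f x - g x) p"
  using analytic_germ_add[OF assms(1) analytic_germ_mult[OF analytic_germ_const[of "-1"] assms(2)]] by simp

lemma analytic_germ_coordinate:
  assumes "b \<in> Basis" shows "analytic_germ (\<lambda>x. x \<bullet> b) p"
proof -
  have "analytic_germ (\<lambda>x. (x - p) \<bullet> b) p"
    unfolding analytic_germ_def using series_bound_coordinate[OF _ assms, of 1 p] zero_less_one by blast
  from analytic_germ_add[OF this analytic_germ_const[of "p \<bullet> b"]] show ?thesis
    by (simp add: inner_diff_left)
qed

text \<open>
  The inner function is recentred to norm \<open>R / 4\<close>, strictly inside the disc where the outer
  series is known to converge absolutely.
\<close>

lemma analytic_germ_compose: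
  assumes f: "analytic_germ f p" and "R > 0"
    and g: "\<And>y. \<bar>y - f p\<bar> < R \<Longrightarrow> (\<lambda>n. b n * (y - f p) ^ n) sums g y"
  shows "analytic_germ (\<lambda>x. g (f x)) p"
proof -
  obtain \<rho>0 M where "\<rho>0 > 0" "series_bound f p \<rho>0 M"
    using f by (auto simp: analytic_germ_def)
  then obtain \<rho> where \<rho>: "\<rho> > 0" "series_bound (\<lambda>x. f x - f p) p \<rho> (R / 4)"
    using series_bound_recentre[of f p \<rho>0 M "R / 4"] \<open>R > 0\<close> by auto
  have "summable (\<lambda>n. b n * (R / 2) ^ n)"
    using g[of "f p + R / 2"] \<open>R > 0\<close> by (auto simp: sums_iff)
  then have "summable (\<lambda>n. norm (b n * (R / 4) ^ n))"
    by (rule powser_insidea) (use \<open>R > 0\<close> in auto)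
  then have s: "summable (\<lambda>n. \<bar>b n\<bar> * (R / 4) ^ n)"
    using \<open>R > 0\<close> by (simp add: abs_mult power_abs)
  have "series_bound (\<lambda>x. g (f x)) p \<rho> (\<Sum>\<^sub>\<infinity>n. \<bar>b n\<bar> * (R / 4) ^ n)"
  proof (rule series_bound_power_series[OF \<rho>(2,1) s])
    fix x assume "x \<in> polydisc p \<rho>"
    from series_bound_abs_le[OF \<rho>(2) this] show "(\<lambda>n. b n * (f x - f p) ^ n) sums g (f x)"
      using \<open>R > 0\<close> by (intro g) auto
  qed
  with \<rho> show ?thesis by (auto simp: analytic_germ_def)
qed

text \<open>
  A real function with a holomorphic extension is the sum of the real part of the Taylor series of the
  extension. This covers all elementary functions occurring in the trace coordinates and their inverse.
\<close>

lemma analytic_germ_compose_holomorphic: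
  assumes f: "analytic_germ f p" and "R > 0"
    and h: "h holomorphic_on ball (of_real (f p)) R"
    and g: "\<And>y. \<bar>y - f p\<bar> < R \<Longrightarrow> h (of_real y) = of_real (g y)"
  shows "analytic_germ (\<lambda>x. g (f x)) p"
proof (rule analytic_germ_compose[OF f \<open>R > 0\<close>])
  fix y assume y: "\<bar>y - f p\<bar> < R"
  then have "complex_of_real y \<in> ball (of_real (f p)) R"
    by (simp add: dist_real_def abs_minus_commute)
  from sums_Re[OF holomorphic_power_series[OF h this]]
  have *: "(\<lambda>n. Re ((deriv ^^ n) h (of_real (f p)) / fact n * (of_real y - of_real (f p)) ^ n)) sums g y"
    by (simp add: g[OF y])
  have "Re (w * (of_real y - of_real (f p)) ^ n) = Re w * (y - f p) ^ n" for w n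
    by (simp flip: of_real_diff of_real_power)
  with * show "(\<lambda>n. Re ((deriv ^^ n) h (of_real (f p)) / fact n) * (y - f p) ^ n) sums g y"
    by (simp only:)
qed


lemma analytic_germ_cos: "analytic_germ f p \<Longrightarrow> analytic_germ (\<lambda>x. cos (f x)) p"
  by (rule analytic_germ_compose_holomorphic[where f = f and g = cos and h = cos and R = 1])
    (assumption, rule zero_less_one, intro holomorphic_intros, rule cos_of_real)

lemma analytic_germ_inverse:
  assumes "analytic_germ f p" "f p \<noteq> 0" shows "analytic_germ (\<lambda>x. inverse (f x)) p"
proof (rule analytic_germ_compose_holomorphic[where f = f and g = inverse and h = inverse and R = "\<bar>f p\<bar>"])
  have "0 \<notin> ball (complex_of_real (f p)) \<bar>f p\<bar>" by (simp add: dist_norm)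
  then show "inverse holomorphic_on ball (complex_of_real (f p)) \<bar>f p\<bar>"
    by (intro holomorphic_on_inverse holomorphic_on_ident) auto
qed (use assms in \<open>simp_all only: of_real_inverse zero_less_abs_iff not_False_eq_True\<close>)

lemma analytic_germ_divide:
  "analytic_germ f p \<Longrightarrow> analytic_germ g p \<Longrightarrow> g p \<noteq> 0 \<Longrightarrow> analytic_germ (\<lambda>x. f x / g x) p"
  unfolding divide_inverse by (intro analytic_germ_mult analytic_germ_inverse)

lemma abs_Re_diff_less_if_in_ball: "z \<in> ball (complex_of_real a) R \<Longrightarrow> \<bar>Re z - a\<bar> < R"
  using abs_Re_le_cmod[of "z - of_real a"] by (simp add: dist_norm norm_minus_commute)

lemma analytic_germ_sqrt:
  assumes "analytic_germ f p" "f p > 0" shows "analytic_germ (\<lambda>x. sqrt (f x)) p"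
proof (rule analytic_germ_compose_holomorphic[where f = f and g = sqrt and h = csqrt and R = "f p"])
  show "csqrt holomorphic_on ball (of_real (f p)) (f p)"
  proof (rule holomorphic_on_csqrt'[OF holomorphic_on_ident])
    fix z assume "z \<in> ball (complex_of_real (f p)) (f p)"
    from abs_Re_diff_less_if_in_ball[OF this] have "Re z > 0" by linarith
    then show "z \<notin> \<real>\<^sub>\<le>\<^sub>0" by (auto simp: complex_nonpos_Reals_iff)
  qed
  show "csqrt (of_real y) = of_real (sqrt y)" if "\<bar>y - f p\<bar> < f p" for y
    using that by (intro csqrt_of_real) linarith
qed (use assms in auto)

lemma analytic_germ_arccos:
  assumes "analytic_germ f p" "\<bar>f p\<bar> < 1" shows "analytic_germ (\<lambda>x. arccos (f x)) p"
proof (rule analytic_germ_compose_holomorphic[where f = f and g = arccos and h = Arccos and R = "1 - \<bar>f p\<bar>"])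
  show "Arccos holomorphic_on ball (of_real (f p)) (1 - \<bar>f p\<bar>)"
    by (rule holomorphic_on_Arccos) (use abs_Re_diff_less_if_in_ball in fastforce)
  show "Arccos (of_real y) = of_real (arccos y)" if "\<bar>y - f p\<bar> < 1 - \<bar>f p\<bar>" for y
    using that by (intro of_real_arccos[symmetric]) linarith
qed (use assms in auto)

lemma has_sum_Pair:
  fixes f :: "'i \<Rightarrow> 'b::real_normed_vector" and g :: "'i \<Rightarrow> 'c::real_normed_vector"
  assumes "(f has_sum a) A" "(g has_sum b) A"
  shows "((\<lambda>x. (f x, g x)) has_sum (a, b)) A"
  using tendsto_Pair[OF assms[unfolded has_sum_def]] by (simp add: has_sum_def sum_prod[abs_def])

lemma real_analytic_on_tripleI:
  fixes f :: "'a::euclidean_space \<Rightarrow> real \<times> real \<times> real"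
  assumes "open S"
    and f: "\<And>x. x \<in> S \<Longrightarrow> f x = (f1 x, f2 x, f3 x)"
    and germ: "\<And>p. p \<in> S \<Longrightarrow> analytic_germ f1 p \<and> analytic_germ f2 p \<and> analytic_germ f3 p"
  shows "real_analytic_on f S"
  unfolding real_analytic_on_def
proof
  fix p assume p: "p \<in> S"
  have ex: "\<exists>\<rho>>0. \<exists>c. \<forall>x\<in>polydisc p \<rho>. ((\<lambda>\<alpha>. c \<alpha> * mi_power (x - p) \<alpha>) has_sum h x) multi_indices"
    if "analytic_germ h p" for h
    using that unfolding analytic_germ_def series_bound_def by blast
  obtain \<rho>1 c1 where 1: "\<rho>1 > 0" "\<And>x. x \<in> polydisc p \<rho>1 \<Longrightarrow> ((\<lambda>\<alpha>. c1 \<alpha> * mi_power (x - p) \<alpha>) has_sum f1 x) multi_indices"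
    using ex germ[OF p] by blast
  obtain \<rho>2 c2 where 2: "\<rho>2 > 0" "\<And>x. x \<in> polydisc p \<rho>2 \<Longrightarrow> ((\<lambda>\<alpha>. c2 \<alpha> * mi_power (x - p) \<alpha>) has_sum f2 x) multi_indices"
    using ex germ[OF p] by blast
  obtain \<rho>3 c3 where 3: "\<rho>3 > 0" "\<And>x. x \<in> polydisc p \<rho>3 \<Longrightarrow> ((\<lambda>\<alpha>. c3 \<alpha> * mi_power (x - p) \<alpha>) has_sum f3 x) multi_indices"
    using ex germ[OF p] by blast
  obtain e0 where e0: "e0 > 0" "ball p e0 \<subseteq> S"
    using \<open>open S\<close> p by (meson openE)
  define e where "e = Min {e0, \<rho>1, \<rho>2, \<rho>3}"
  have e: "e > 0" "e \<le> e0" "e \<le> \<rho>1" "e \<le> \<rho>2" "e \<le> \<rho>3"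
    using e0 1(1) 2(1) 3(1) by (auto simp: e_def)
  have poly: "x \<in> polydisc p \<rho>" if "x \<in> ball p e" "e \<le> \<rho>" for x \<rho>
    unfolding polydisc_def
  proof clarify
    fix b :: 'a assume "b \<in> Basis"
    then have "\<bar>(x - p) \<bullet> b\<bar> \<le> norm (x - p)" by (rule Basis_le_norm)
    also have "\<dots> \<le> \<rho>" using that by (simp add: dist_norm norm_minus_commute)
    finally show "\<bar>(x - p) \<bullet> b\<bar> \<le> \<rho>" .
  qed
  have "((\<lambda>\<alpha>. (\<Prod>b\<in>Basis. ((x - p) \<bullet> b) ^ \<alpha> b) *\<^sub>R (c1 \<alpha>, c2 \<alpha>, c3 \<alpha>)) has_sum f x) (Basis \<rightarrow>\<^sub>E UNIV)"
    if x: "x \<in> ball p e" for x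
  proof -
    have "x \<in> S" using x e e0 by auto
    show ?thesis
      using has_sum_Pair[OF 1(2)[OF poly[OF x]] has_sum_Pair[OF 2(2)[OF poly[OF x]] 3(2)[OF poly[OF x]]]] e
      by (simp add: f[OF \<open>x \<in> S\<close>] mi_power_def multi_indices_def mult.commute)
  qed
  moreover have "ball p e \<subseteq> S" using e e0 by auto
  ultimately show "\<exists>e>0. ball p e \<subseteq> S \<and>
      (\<exists>c. \<forall>x\<in>ball p e. ((\<lambda>\<alpha>. (\<Prod>b\<in>Basis. ((x - p) \<bullet> b) ^ \<alpha> b) *\<^sub>R c \<alpha>) has_sum f x) (Basis \<rightarrow>\<^sub>E UNIV))"
    using e(1) by (intro exI[of _ e] conjI exI[of _ "\<lambda>\<alpha>. (c1 \<alpha>, c2 \<alpha>, c3 \<alpha>)"]) auto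
qed

lemma analytic_germ_triple_coordinates:
  fixes p :: "real \<times> real \<times> real"
  shows "analytic_germ fst p" "analytic_germ (\<lambda>v. fst (snd v)) p" "analytic_germ (\<lambda>v. snd (snd v)) p"
  using analytic_germ_coordinate[of "(1, 0, 0)" p] analytic_germ_coordinate[of "(0, 1, 0)" p]
    analytic_germ_coordinate[of "(0, 0, 1)" p]
  by (simp_all add: Basis_prod_def inner_prod_def zero_prod_def)

section \<open>The analytic diffeomorphism\<close>

lemma real_analytic_params_to_traces:
  assumes "\<And>v. v \<in> regular_params \<Longrightarrow> f v = params_to_traces v"
  shows "real_analytic_on f regular_params"
proof (rule real_analytic_on_tripleI[OF open_regular_params])
  show "f v = (fst v * cos (fst (snd v)) + cos (snd (snd v)) / fst v,
      cos (fst (snd v)) / fst v + fst v * cos (snd (snd v)), fst v * fst v + inverse (fst v * fst v))"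
    if "v \<in> regular_params" for v
    using assms[OF that] by (simp add: params_to_traces_def case_prod_beta power2_eq_square)
  fix p assume p: "p \<in> regular_params"
  note coords = analytic_germ_triple_coordinates[of p]
  have nz: "fst p \<noteq> 0" "fst p * fst p \<noteq> 0" using p by (auto simp: regular_params_def)
  have "analytic_germ (\<lambda>v. fst v * cos (fst (snd v)) + cos (snd (snd v)) / fst v) p"
    by (intro analytic_germ_add analytic_germ_mult analytic_germ_divide analytic_germ_cos coords nz)
  moreover have "analytic_germ (\<lambda>v. cos (fst (snd v)) / fst v + fst v * cos (snd (snd v))) p"
    by (intro analytic_germ_add analytic_germ_mult analytic_germ_divide analytic_germ_cos coords nz)
  moreover have "analytic_germ (\<lambda>v. fst v * fst v + inverse (fst v * fst v)) p"
    by (intro analytic_germ_add analytic_germ_mult analytic_germ_inverse coords nz)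
  ultimately show "analytic_germ (\<lambda>v. fst v * cos (fst (snd v)) + cos (snd (snd v)) / fst v) p \<and>
      analytic_germ (\<lambda>v. cos (fst (snd v)) / fst v + fst v * cos (snd (snd v))) p \<and>
      analytic_germ (\<lambda>v. fst v * fst v + inverse (fst v * fst v)) p"
    by blast
qed

lemma real_analytic_traces_to_params:
  assumes "\<And>v. v \<in> D_region \<Longrightarrow> f v = traces_to_params v"
  shows "real_analytic_on f D_region"
proof (rule real_analytic_on_tripleI[OF open_D_region])
  let ?a = "\<lambda>v :: real \<times> real \<times> real. (fst v + fst (snd v)) / sqrt (snd (snd v) + 2)"
  let ?b = "\<lambda>v :: real \<times> real \<times> real. (fst v - fst (snd v)) / sqrt (snd (snd v) - 2)"
  show "f v = ((sqrt (snd (snd v) + 2) + sqrt (snd (snd v) - 2)) / 2,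
      arccos ((?a v + ?b v) / 2), arccos ((?a v - ?b v) / 2))" if "v \<in> D_region" for v
    using assms[OF that] by (simp add: traces_to_params_def case_prod_beta)
  fix p assume p: "p \<in> D_region"
  then have z: "snd (snd p) > 2" and ab: "\<bar>?a p + ?b p\<bar> < 2" "\<bar>?a p - ?b p\<bar> < 2"
    by (auto simp: D_region_def)
  note coords = analytic_germ_triple_coordinates[of p]
  have R: "analytic_germ (\<lambda>v. sqrt (snd (snd v) + 2)) p" and S: "analytic_germ (\<lambda>v. sqrt (snd (snd v) - 2)) p"
    using z by (intro analytic_germ_sqrt analytic_germ_add analytic_germ_diff analytic_germ_const coords; simp)+
  have a: "analytic_germ ?a p" and b: "analytic_germ ?b p"
    using z by (intro analytic_germ_divide analytic_germ_add analytic_germ_diff R S coords; simp)+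
  have "analytic_germ (\<lambda>v. (sqrt (snd (snd v) + 2) + sqrt (snd (snd v) - 2)) / 2) p"
    by (intro analytic_germ_divide analytic_germ_add R S analytic_germ_const) simp
  moreover have "analytic_germ (\<lambda>v. arccos ((?a v + ?b v) / 2)) p"
    using ab(1) by (intro analytic_germ_arccos analytic_germ_divide analytic_germ_add a b analytic_germ_const) auto
  moreover have "analytic_germ (\<lambda>v. arccos ((?a v - ?b v) / 2)) p"
    using ab(2) by (intro analytic_germ_arccos analytic_germ_divide analytic_germ_diff a b analytic_germ_const) auto
  ultimately show "analytic_germ (\<lambda>v. (sqrt (snd (snd v) + 2) + sqrt (snd (snd v) - 2)) / 2) p \<and>
    analytic_germ (\<lambda>v. arccos ((?a v + ?b v) / 2)) p \<and> analytic_germ (\<lambda>v. arccos ((?a v - ?b v) / 2)) p"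
    by blast
qed

lemma real_analytic_diffeo_trace_nu:
  "real_analytic_diffeo_in_chart (on_class lox_params) regular_params (on_class trace_nu) reg_lox_classes D_region"
  unfolding real_analytic_diffeo_in_chart_def real_analytic_diffeo_def
proof (intro conjI)
  let ?h = "on_class lox_params" and ?f = "on_class trace_nu"
  show h: "bij_betw ?h reg_lox_classes regular_params" by (rule bij_betw_lox_params)
  have f: "?f C = params_to_traces (?h C)" if C: "C \<in> reg_lox_classes" for C
  proof -
    have "C \<in> lox_classes" using C reg_lox_classes_subset by (rule rev_subsetD)
    then obtain A r \<theta> \<phi> where
      "A \<in> SL2H" "C = SL2H_conj `` {A}" "lox_normal_form A r \<theta> \<phi>"
      by (rule lox_classes_cases)
    then show ?thesis by (simp add: on_class_lox trace_nu_eq lox_params_eq)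
  qed
  have comp: "(?f \<circ> the_inv_into reg_lox_classes ?h) v = params_to_traces v" if v: "v \<in> regular_params" for v
  proof -
    have "the_inv_into reg_lox_classes ?h v \<in> reg_lox_classes" "?h (the_inv_into reg_lox_classes ?h v) = v"
      using h v by (auto simp: bij_betw_def the_inv_into_into f_the_inv_into_f)
    then show ?thesis by (simp add: f)
  qed
  show bij: "bij_betw (?f \<circ> the_inv_into reg_lox_classes ?h) regular_params D_region"
    using bij_betw_cong[THEN iffD2, OF comp bij_betw_params_to_traces] .
  show "bij_betw ?f reg_lox_classes D_region"
    using bij_betw_trans[OF h bij_betw_params_to_traces]
    by (rule bij_betw_cong[THEN iffD2, rotated]) (simp add: f)
  show "open regular_params" "open D_region" by (rule open_regular_params open_D_region)+
  show "real_analytic_on (?f \<circ> the_inv_into reg_lox_classes ?h) regular_params"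
    by (rule real_analytic_params_to_traces) (rule comp)
  show "real_analytic_on (the_inv_into regular_params (?f \<circ> the_inv_into reg_lox_classes ?h)) D_region"
  proof (rule real_analytic_traces_to_params)
    fix v assume v: "v \<in> D_region"
    show "the_inv_into regular_params (?f \<circ> the_inv_into reg_lox_classes ?h) v = traces_to_params v"
      by (rule the_inv_into_f_eq[OF bij_betw_imp_inj_on[OF bij]])
        (use traces_to_params_right_inverse[OF v] comp in simp_all)
  qed
qed

theorem theorem1p1:
  shows "(\<forall>A. loxodromic A \<longrightarrow>
            on_class trace_nu (SL2H_conj `` {A}) = (tr A, tr (matrix_inv A), nu A) \<and>
            on_class trace_sq (SL2H_conj `` {A}) = (tr A, tr (matrix_inv A), tr (A ** A)))
       \<and> inj_on (on_class trace_nu) lox_classes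
       \<and> inj_on (on_class trace_sq) lox_classes
       \<and> (\<exists>F G :: real \<times> real \<times> real \<Rightarrow> real \<times> real \<times> real. \<forall>C\<in>lox_classes.
            on_class trace_sq C = F (on_class trace_nu C) \<and>
            on_class trace_nu C = G (on_class trace_sq C))
       \<and> real_analytic_diffeo_in_chart
            (on_class lox_params) ({1<..} \<times> {0<..<pi} \<times> {0<..<pi})
            (on_class trace_nu) reg_lox_classes D_region"
proof (intro conjI allI impI)
  show inj: "inj_on (on_class trace_nu) lox_classes" "inj_on (on_class trace_sq) lox_classes"
    by (rule inj_on_lox_classes[OF on_class_lox(1) lox_normal_form_determined_by_trace_nu]; assumption)
      (rule inj_on_lox_classes[OF on_class_lox(2) lox_normal_form_unique]; assumption)
  show "\<exists>F G :: real \<times> real \<times> real \<Rightarrow> real \<times> real \<times> real. \<forall>C\<in>lox_classes.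
            on_class trace_sq C = F (on_class trace_nu C) \<and> on_class trace_nu C = G (on_class trace_sq C)"
    by (intro exI[of _ "on_class trace_sq \<circ> the_inv_into lox_classes (on_class trace_nu)"]
        exI[of _ "on_class trace_nu \<circ> the_inv_into lox_classes (on_class trace_sq)"])
      (simp add: the_inv_into_f_f inj)
qed (use real_analytic_diffeo_trace_nu in
    \<open>simp_all add: on_class_lox loxodromic_in_SL2H trace_nu_def trace_sq_def regular_params_def\<close>)

end
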